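(* Let $p_1>p_2>\cdots>p_L$ be distinct primes, let $D=p_1\cdots p_L$, and let $t\in(1,\infty]$. The infimum in $M_t(\sqrt D)$ is attained in $\mathbb{Q}(\sqrt D)$ if and only if $D<p_1^2$. In this situation, the infimum is attained by the points $\sqrt{\frac{p_1}{p_2\cdots p_L}},\,p_2,\,\ldots,\,p_L\in\mathbb{Q}(\sqrt D)$, and $M_t(\sqrt D)=\left(\sum_{\ell=1}^L(\log p_\ell)^t\right)^{1/t}$ if $t\in(1,\infty)$, while $M_\infty(\sqrt D)=\log p_1$.
   Context: For a polynomial $f(z)=a\prod_{n=1}^N(z-\beta_n)\in\mathbb{C}[z]$, its (logarithmic) Mahler measure is $M(f)=\log|a|+\sum_{n=1}^N\log^+|\beta_n|$, where $\log^+x=\max\{0,\log x\}$. For a non-zero algebraic number $\beta$, $M(\beta)$ is the Mahler measure of the minimal polynomial of $\beta$ over $\mathbb{Z}$. For $t\in[1,\infty)$ and $\beta\in\overline{\mathbb{Q}}^\times$, $M_t(\beta)=\inf\{(\sum_{n=1}^N M(\beta_n)^t)^{1/t}: N\in\mathbb{N},\ \beta_n\in\overline{\mathbb{Q}}^\times,\ \beta=\prod_{n=1}^N\beta_n\}$, and $M_\infty(\beta)=\inf\{\max_{1\le n\le N}M(\beta_n): N\in\mathbb{N},\ \beta_n\in\overline{\mathbb{Q}}^\times,\ \beta=\prod_{n=1}^N\beta_n\}$. The infimum in $M_t(\beta)$ is attained by $\beta_1,\ldots,\beta_N$ if $\beta=\beta_1\cdots\beta_N$ and $M_t(\beta)$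 equals $(\sum_n M(\beta_n)^t)^{1/t}$ (for $t<\infty$) or $\max_n M(\beta_n)$ (for $t=\infty$); it is attained in a set $S\subseteq\overline{\mathbb{Q}}$ if it is attained by some points $\beta_1,\ldots,\beta_N\in S$. *)

theory Defs
  imports
    "HOL-Computational_Algebra.Computational_Algebra"
    "HOL-Library.Extended_Real"
begin

abbreviation cpoly :: "int poly \<Rightarrow> complex poly" where
  "cpoly f \<equiv> map_poly of_int f"

text \<open>Since \<open>ln 0 = 0\<close> in HOL, a root \<open>0\<close> contributes \<open>0\<close>, as it should.\<close>

definition log_mahler :: "complex poly \<Rightarrow> real" where
  "log_mahler f = ln (cmod (lead_coeff f)) + (\<Sum>\<beta>\<in>#proots f. max 0 (ln (cmod \<beta>)))"

definition is_min_int_poly :: "complex \<Rightarrow> int poly \<Rightarrow> bool" where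
  "is_min_int_poly \<beta> f \<longleftrightarrow> irreducible f \<and> lead_coeff f > 0 \<and> poly (cpoly f) \<beta> = 0"

definition min_int_poly :: "complex \<Rightarrow> int poly" where
  "min_int_poly \<beta> = (THE f. is_min_int_poly \<beta> f)"

lemma cpoly_mult: "cpoly (f * g) = cpoly f * cpoly g"
  by (rule poly_eqI) (simp add: coeff_map_poly coeff_mult)

lemma cpoly_add: "cpoly (f + g) = cpoly f + cpoly g"
  by (rule poly_eqI) (simp add: coeff_map_poly)

lemma ex_irreducible_root_factor:
  fixes p :: "int poly"
  assumes "p \<noteq> 0" and "poly (cpoly p) \<beta> = 0"
  shows "\<exists>h. irreducible h \<and> h dvd p \<and> poly (cpoly h) \<beta> = 0"
  using assms
proof (induction p rule: prime_divisors_induct)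
  case zero
  then show ?case by simp
next
  case (unit x)
  then obtain y where y: "1 = x * y" by (auto elim: dvdE)
  have "poly (cpoly (x * y)) \<beta> = 1" by (simp flip: y)
  with unit show ?case by (simp add: cpoly_mult)
next
  case (factor q x)
  have irr: "irreducible q"
    using factor.hyps by (intro prime_elem_imp_irreducible) (auto simp: prime_def)
  show ?case
  proof (cases "poly (cpoly q) \<beta> = 0")
    case True
    then show ?thesis using irr by auto
  next
    case False
    then show ?thesis using factor by (auto simp: cpoly_mult)
  qed
qed

lemma ex1_is_min_int_poly:
  assumes "algebraic \<beta>"
  shows "\<exists>!f. is_min_int_poly \<beta> f"
proof -
  define P where "P = (\<lambda>f. f \<noteq> 0 \<and> poly (cpoly f) \<beta> = 0)"
  obtain f0 where "P f0" using assms unfolding P_def by (elim algebraicE') auto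
  then obtain g where g: "P g" and g_min: "\<And>f. P f \<Longrightarrow> degree g \<le> degree f"
    using exists_least_iff[of "\<lambda>n. \<exists>f. P f \<and> degree f = n"] by (metis not_le)
  obtain h where h: "irreducible h" "h dvd g" "poly (cpoly h) \<beta> = 0"
    using ex_irreducible_root_factor[of g \<beta>] g unfolding P_def by blast
  have h0: "h \<noteq> 0" using h(1) by auto
  have h_min: "degree h \<le> degree f" if "P f" for f
    using dvd_imp_degree_le[OF h(2)] g g_min[OF that] by (auto simp: P_def)
  have h_deg: "degree h > 0"
  proof (rule ccontr)
    assume "\<not> degree h > 0"
    then obtain c where "h = [:c:]" by (auto elim: degree_eq_zeroE)
    with h h0 show False by (simp add: map_poly_pCons)
  qed
  have assoc: "h dvd f \<and> f dvd h" if f: "irreducible f" "poly (cpoly f) \<beta> = 0" for f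
  proof -
    define r where "r = pseudo_mod f h"
    obtain a q where a: "a \<noteq> 0" "smult a f = h * q + r"
      and r: "r = 0 \<or> degree r < degree h"
      using pseudo_mod[OF h0, of f] unfolding r_def by blast
    have "poly (cpoly ([:a:] * f)) \<beta> = 0" by (simp only: cpoly_mult poly_mult f(2)) simp
    then have "poly (cpoly r) \<beta> = 0"
      using a(2) h(3) by (simp add: cpoly_mult cpoly_add)
    with r h_min[of r] have "r = 0" unfolding P_def by linarith
    with a have "h dvd [:a:] * f" by simp
    moreover have "prime_elem h" using h(1) by (rule irreducible_imp_prime_elem)
    moreover have "\<not> h dvd [:a:]"
      using dvd_imp_degree_le[of h "[:a:]"] a(1) h_deg by auto
    ultimately have hf: "h dvd f" by (blast dest: prime_elem_dvd_multD)
    with f(1) h(1) have "f dvd h" by (blast dest: irreducibleD' irreducible_not_unit)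
    with hf show ?thesis ..
  qed
  show ?thesis
  proof (rule ex_ex1I)
    show "\<exists>f. is_min_int_poly \<beta> f"
    proof (cases "lead_coeff h > 0")
      case True
      with h show ?thesis by (auto simp: is_min_int_poly_def)
    next
      case False
      then have "lead_coeff (- h) > 0" using h0 by (simp add: less_le)
      moreover have "cpoly (- h) = - cpoly h" by (rule poly_eqI) (simp add: coeff_map_poly)
      moreover have "irreducible (- h)"
        using h(1) irreducible_mult_unit_left[of "- 1" h] by simp
      ultimately show ?thesis using h by (auto simp: is_min_int_poly_def intro!: exI[of _ "- h"])
    qed
  next
    fix f g assume fg: "is_min_int_poly \<beta> f" "is_min_int_poly \<beta> g"
    then have "h dvd f" "f dvd h" "h dvd g" "g dvd h"
      using assoc unfolding is_min_int_poly_def by blast+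
    then have dvd: "f dvd g" "g dvd f" by (blast intro: dvd_trans)+
    have norm: "normalize x = x" if "lead_coeff x > 0" for x :: "int poly"
    proof -
      have "unit_factor x = 1"
        using that by (simp add: unit_factor_poly_def monom_0 one_pCons)
      then show ?thesis by (metis div_by_1 div_unit_factor)
    qed
    have "normalize f = f" "normalize g = g"
      using fg norm unfolding is_min_int_poly_def by blast+
    with dvd show "f = g" by (rule associated_eqI)
  qed
qed

definition log_mahler_alg :: "complex \<Rightarrow> real" where
  "log_mahler_alg \<beta> = log_mahler (cpoly (min_int_poly \<beta>))"

definition is_factorization :: "complex \<Rightarrow> complex list \<Rightarrow> bool" where
  "is_factorization \<beta> \<beta>s \<longleftrightarrow>
     \<beta>s \<noteq> [] \<and> (\<forall>x\<in>set \<beta>s. algebraic x \<and> x \<noteq> 0) \<and> \<beta> = prod_list \<beta>s"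

definition mahler_lt :: "ereal \<Rightarrow> complex list \<Rightarrow> real" where
  "mahler_lt t \<beta>s =
     (if t = \<infinity> then Max (log_mahler_alg ` set \<beta>s)
      else (\<Sum>x\<leftarrow>\<beta>s. log_mahler_alg x powr real_of_ereal t) powr (1 / real_of_ereal t))"

text \<open>Intended for \<open>1 \<le> t \<le> \<infinity>\<close> and \<open>\<beta>\<close> algebraic and non-zero.\<close>

definition metric_mahler :: "ereal \<Rightarrow> complex \<Rightarrow> real" where
  "metric_mahler t \<beta> = Inf {mahler_lt t \<beta>s |\<beta>s. is_factorization \<beta> \<beta>s}"

definition attained_by :: "ereal \<Rightarrow> complex \<Rightarrow> complex list \<Rightarrow> bool" where
  "attained_by t \<beta> \<beta>s \<longleftrightarrow> is_factorization \<beta> \<beta>s \<and> metric_mahler t \<beta> = mahler_lt t \<beta>s"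

definition attained_in :: "ereal \<Rightarrow> complex \<Rightarrow> complex set \<Rightarrow> bool" where
  "attained_in t \<beta> S \<longleftrightarrow> (\<exists>\<beta>s. set \<beta>s \<subseteq> S \<and> attained_by t \<beta> \<beta>s)"

definition is_complex_subfield :: "complex set \<Rightarrow> bool" where
  "is_complex_subfield K \<longleftrightarrow> 0 \<in> K \<and> 1 \<in> K \<and>
     (\<forall>x\<in>K. \<forall>y\<in>K. x + y \<in> K \<and> x * y \<in> K) \<and> (\<forall>x\<in>K. - x \<in> K \<and> inverse x \<in> K)"

definition rat_adjoin :: "complex \<Rightarrow> complex set" where
  "rat_adjoin \<alpha> = \<Inter> {K. is_complex_subfield K \<and> \<alpha> \<in> K}"

end

theory Submission
  imports Defs
begin

text \<open>
  In a factorization \<open>\<surd>D = \<beta>\<^sub>1 \<cdots> \<beta>\<^sub>N\<close> every prime \<open>p\<close> dividing \<open>D\<close> divides the constant coefficient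
  \<open>c\<^sub>n\<close> of the minimal polynomial of some \<open>\<beta>\<^sub>n\<close>: otherwise \<open>c\<^sub>1 \<cdots> c\<^sub>N / \<surd>D\<close>, a product of the
  algebraic integers \<open>c\<^sub>n / \<beta>\<^sub>n\<close>, would have a square with \<open>p\<close> in the denominator. As
  \<open>M(\<beta>\<^sub>n) \<ge> log \<bar>c\<^sub>n\<bar>\<close>, grouping the primes by the factor they are assigned to gives
  \<open>\<Sum> M(\<beta>\<^sub>n)\<^sup>t \<ge> \<Sum> (log p)\<^sup>t\<close>, with strict inequality if some \<open>M(\<beta>\<^sub>n)\<close> exceeds \<open>log p\<^sub>1\<close>. The
  factors \<open>\<surd>p\<close> attain this bound for every \<open>D\<close>, and the points of the theorem do if \<open>D < p\<^sub>1\<^sup>2\<close>.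

  Conversely, if the infimum is attained in \<open>\<rat>(\<surd>D)\<close>, then all \<open>M(\<beta>\<^sub>n) \<le> log p\<^sub>1\<close>. Since the norm of
  \<open>\<surd>D\<close> is \<open>-D\<close>, some \<open>\<beta>\<^sub>n\<close> has a norm with odd \<open>p\<^sub>1\<close>-adic valuation. It is irrational, and in its minimal
  polynomial \<open>aX\<^sup>2 + bX + c\<close> exactly one of \<open>\<bar>a\<bar>\<close>, \<open>\<bar>c\<bar>\<close> equals \<open>p\<^sub>1\<close>, while \<open>p\<^sub>1\<close> divides \<open>b\<close> because \<open>D\<close>
  divides the discriminant. The Mahler bound puts both roots on the same side of the unit circle, so
  either \<open>ac > 0\<close>, \<open>\<bar>b\<bar> = p\<^sub>1\<close> and \<open>D \<le> b\<^sup>2 - 4ac < p\<^sub>1\<^sup>2\<close>, or \<open>ac < 0\<close>, \<open>b = 0\<close> and \<open>D \<le> \<bar>ac\<bar> < p\<^sub>1\<^sup>2\<close>.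
\<close>

section \<open>Numbers whose powers span a finitely generated group\<close>

text \<open>Adding one integer multiple of a generator at a time makes each closure property a rule
  induction.\<close>

inductive_set int_span :: "complex set \<Rightarrow> complex set" for F where
  zero: "0 \<in> int_span F"
| step: "x \<in> F \<Longrightarrow> z \<in> int_span F \<Longrightarrow> of_int c * x + z \<in> int_span F"

lemma int_span_base: "x \<in> F \<Longrightarrow> x \<in> int_span F"
  using int_span.step[of x F 0 1] int_span.zero by simp

lemma int_span_add: "x \<in> int_span F \<Longrightarrow> y \<in> int_span F \<Longrightarrow> x + y \<in> int_span F"
  by (induction rule: int_span.induct) (auto intro: int_span.step simp: add.assoc)

lemma int_span_scale: "x \<in> int_span F \<Longrightarrow> of_int k * x \<in> int_span F"
proof (induction rule: int_span.induct)
  case zero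
  then show ?case by (simp add: int_span.zero)
next
  case (step x z c)
  then show ?case using int_span.step[of x F "of_int k * z" "k * c"] by (simp add: algebra_simps)
qed

lemma int_span_sum: "(\<And>i. i \<in> A \<Longrightarrow> f i \<in> int_span F) \<Longrightarrow> sum f A \<in> int_span F"
  by (induction A rule: infinite_finite_induct) (auto intro: int_span.zero int_span_add)

text \<open>The set \<open>{1}\<close> is linearly independent over \<rat>, so the map fixing 1
  extends linearly along a basis of \<complex>.\<close>

lemma rat_linear_retraction:
  obtains g :: "complex \<Rightarrow> rat"
  where "\<And>x y. g (x + y) = g x + g y" "\<And>r x. g (of_rat r * x) = r * g x" "g 1 = 1"
proof -
  interpret vector_space_pair
    "\<lambda>(q::rat) (z::complex). of_rat q * z" "\<lambda>(q::rat) (r::rat). q * r"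
    by unfold_locales (simp_all add: algebra_simps of_rat_add of_rat_mult)
  have "\<not> vs1.dependent {1::complex}"
    by simp
  then obtain g where g: "Vector_Spaces.linear (\<lambda>(q::rat) (z::complex). of_rat q * z) (*) g"
      and g1: "g 1 = (1 :: rat)"
    using linear_independent_extend[of "{1}" "\<lambda>_. 1"] by auto
  interpret g: Vector_Spaces.linear "\<lambda>(q::rat) (z::complex). of_rat q * z" "(*)" g
    by (rule g)
  show thesis using that g.add g.scale g1 by blast
qed

text \<open>This characterizes the algebraic integers. In this form a product needs no polynomial of
  its own: the generators are multiplied pairwise.\<close>

definition powers_fin_gen :: "complex \<Rightarrow> bool" where
  "powers_fin_gen x \<longleftrightarrow> (\<exists>F. finite F \<and> (\<forall>k. x ^ k \<in> int_span F))"

lemma int_span_mult: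
  assumes "x \<in> int_span F" "y \<in> int_span G"
  shows "x * y \<in> int_span ((\<lambda>(f, g). f * g) ` (F \<times> G))" (is "_ \<in> ?S")
proof -
  have *: "f * y \<in> ?S" if "f \<in> F" for f
    using assms(2)
  proof (induction rule: int_span.induct)
    case zero
    then show ?case by (simp add: int_span.zero)
  next
    case (step g z c)
    have "f * g \<in> ?S" using that step by (intro int_span_base) auto
    then have "of_int c * (f * g) + f * z \<in> ?S"
      using step by (intro int_span_add int_span_scale)
    then show ?case by (simp add: algebra_simps)
  qed
  show ?thesis
    using assms(1)
  proof (induction rule: int_span.induct)
    case zero
    then show ?case by (simp add: int_span.zero)
  next
    case (step f z c)
    then have "of_int c * (f * y) + z * y \<in> ?S"
      using * by (intro int_span_add int_span_scale) auto
    then show ?case by (simp add: algebra_simps)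
  qed
qed

lemma powers_fin_gen_1: "powers_fin_gen 1"
  unfolding powers_fin_gen_def
  by (intro exI[of _ "{1}"]) (auto intro: int_span_base)

lemma powers_fin_gen_mult:
  assumes "powers_fin_gen x" "powers_fin_gen y"
  shows "powers_fin_gen (x * y)"
proof -
  obtain F G where "finite F" "finite G"
    "\<And>k. x ^ k \<in> int_span F" "\<And>k. y ^ k \<in> int_span G"
    using assms unfolding powers_fin_gen_def by blast
  then show ?thesis
    unfolding powers_fin_gen_def power_mult_distrib
    by (intro exI[of _ "(\<lambda>(f, g). f * g) ` (F \<times> G)"]) (auto intro: int_span_mult)
qed

lemma powers_fin_gen_prod_list:
  "(\<And>x. x \<in> set xs \<Longrightarrow> powers_fin_gen x) \<Longrightarrow> powers_fin_gen (prod_list xs)"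
  by (induction xs) (auto intro: powers_fin_gen_1 powers_fin_gen_mult)

text \<open>The hypothesis is a monic integer equation for \<open>x\<close>. It brings back the only
  power that leaves the span of the lower ones under multiplication by \<open>x\<close>.\<close>

lemma powers_fin_genI:
  assumes "x ^ d \<in> int_span ((^) x ` {..<d})"
  shows "powers_fin_gen x"
proof -
  let ?S = "int_span ((^) x ` {..<d})"
  have step: "x * z \<in> ?S" if "z \<in> ?S" for z
    using that
  proof (induction rule: int_span.induct)
    case zero
    then show ?case by (simp add: int_span.zero)
  next
    case (step g z c)
    then obtain i where i: "i < d" "g = x ^ i" by auto
    have "x ^ Suc i \<in> ?S"
    proof (cases "Suc i = d")
      case True
      then show ?thesis using assms by simp
    next
      case False
      then show ?thesis using i by (intro int_span_base imageI) auto
    qed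
    then have "of_int c * (x ^ Suc i) + x * z \<in> ?S"
      using step by (intro int_span_add int_span_scale)
    then show ?case by (simp add: algebra_simps i)
  qed
  have "x ^ k \<in> ?S" for k
  proof (induction k)
    case 0
    show ?case
    proof (cases "d = 0")
      case True
      then show ?thesis using assms by simp
    next
      case False
      then show ?thesis by (intro int_span_base imageI) auto
    qed
  qed (use step in auto)
  then show ?thesis unfolding powers_fin_gen_def by blast
qed

text \<open>For \<open>x = c / \<beta>\<close> with \<open>c\<close> the constant coefficient,
  \<open>\<beta> ^ i * x ^ d = c ^ i * x ^ (d - i)\<close>. Multiplying
  \<open>f(\<beta>) = 0\<close> by \<open>x ^ d / c\<close> thus gives a monic integer equation for
  \<open>x\<close>.\<close>

lemma powers_fin_gen_const_coeff_div_root: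
  fixes f :: "int poly"
  assumes root: "poly (cpoly f) \<beta> = 0" and "\<beta> \<noteq> 0" and f0: "coeff f 0 \<noteq> 0"
  shows "powers_fin_gen (of_int (coeff f 0) / \<beta>)"
proof (rule powers_fin_genI)
  define c where "c = coeff f 0"
  define d where "d = degree f"
  define x where "x = of_int c / \<beta>"
  have c: "c \<noteq> 0" using f0 by (simp add: c_def)
  have \<beta>: "\<beta> = of_int c / x" "x \<noteq> 0" using c assms(2) by (auto simp: x_def)
  have deg: "degree (cpoly f) = d" unfolding d_def by (rule degree_map_poly) simp
  have "0 = (\<Sum>i\<le>d. of_int (coeff f i) * \<beta> ^ i)"
    using root by (simp add: poly_altdef deg coeff_map_poly)
  also have "\<dots> = of_int c + (\<Sum>i\<in>{1..d}. of_int (coeff f i) * \<beta> ^ i)"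
  proof -
    have "{..d} = insert 0 {1..d}" by auto
    then show ?thesis by (simp add: c_def)
  qed
  finally have "of_int c * x ^ d = - (\<Sum>i\<in>{1..d}. of_int (coeff f i) * \<beta> ^ i) * x ^ d"
    by (simp add: add_eq_0_iff)
  also have "\<dots> = (\<Sum>i\<in>{1..d}. of_int (- coeff f i) * \<beta> ^ i * x ^ d)"
    by (simp add: sum_negf sum_distrib_right)
  also have "\<dots> = (\<Sum>i\<in>{1..d}. of_int c * (of_int (- coeff f i * c ^ (i - 1)) * x ^ (d - i)))"
  proof (rule sum.cong)
    fix i assume i: "i \<in> {1..d}"
    have "x ^ d = x ^ i * x ^ (d - i)" using i by (simp flip: power_add)
    \<comment> \<open>As \<open>i\<close> starts at 1, every term has a factor \<open>c\<close>,
      which is cancelled below.\<close>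
    moreover have "of_int c ^ i = of_int c * (of_int c ^ (i - 1) :: complex)"
      using i by (cases i) auto
    ultimately show "of_int (- coeff f i) * \<beta> ^ i * x ^ d =
        of_int c * (of_int (- coeff f i * c ^ (i - 1)) * x ^ (d - i))"
      using \<beta> by (simp add: power_divide)
  qed simp
  finally have "x ^ d = (\<Sum>i\<in>{1..d}. of_int (- coeff f i * c ^ (i - 1)) * x ^ (d - i))"
    using c unfolding sum_distrib_left[symmetric] by simp
  also have "\<dots> \<in> int_span ((^) x ` {..<d})"
    by (intro int_span_sum int_span_scale int_span_base imageI) auto
  finally show "(of_int (coeff f 0) / \<beta>) ^ d \<in>
      int_span ((^) (of_int (coeff f 0) / \<beta>) ` {..<d})"
    by (simp add: x_def c_def)
qed

text \<open>A \<open>\<rat>\<close>-linear retraction of \<open>\<complex>\<close> onto \<open>\<rat>\<close> maps a finitely generated group to one with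
  bounded denominators, and it fixes the powers of a rational number.\<close>

lemma powers_fin_gen_rat_bounded_denominator:
  assumes "powers_fin_gen (of_rat q)"
  shows "\<exists>N::int. N > 0 \<and> (\<forall>k. of_int N * q ^ k \<in> \<int>)"
proof -
  obtain F where F: "finite F" "\<And>k. of_rat q ^ k \<in> int_span F"
    using assms unfolding powers_fin_gen_def by blast
  obtain g :: "complex \<Rightarrow> rat" where g:
    "\<And>x y. g (x + y) = g x + g y" "\<And>r x. g (of_rat r * x) = r * g x" "g 1 = 1"
    using rat_linear_retraction by blast
  have g_rat: "g (of_rat r) = r" for r
    using g(2)[of r 1] g(3) by simp
  define den where "den = (\<lambda>x. snd (quotient_of (g x)))"
  define N where "N = (\<Prod>x\<in>F. den x)"
  have den: "den x > 0" for x unfolding den_def by (rule quotient_of_denom_pos')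
  have den_int: "of_int (den x) * g x \<in> \<int>" for x
  proof -
    have "g x = of_int (fst (quotient_of (g x))) / of_int (den x)"
      unfolding den_def by (rule quotient_of_div) simp
    then show ?thesis using den[of x] by (metis Ints_of_int nonzero_mult_div_cancel_left
      of_int_eq_0_iff order_less_irrefl times_divide_eq_right)
  qed
  have "of_int N * g z \<in> \<int>" if "z \<in> int_span F" for z
    using that
  proof (induction rule: int_span.induct)
    case zero
    then show ?case using g(2)[of 0 0] by simp
  next
    case (step x z c)
    have "N = (\<Prod>x\<in>F - {x}. den x) * den x"
      unfolding N_def using step F by (simp add: prod.remove mult.commute)
    then have "of_int N * g x = of_int (\<Prod>x\<in>F - {x}. den x) * (of_int (den x) * g x)"
      by simp
    then have "of_int N * g x \<in> \<int>" using den_int by (metis Ints_mult Ints_of_int)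
    moreover have "g (of_int c * x + z) = of_int c * g x + g z"
      using g(1) g(2)[of "of_int c" x] by simp
    moreover have "of_int N * (of_int c * g x + g z) = of_int c * (of_int N * g x) + of_int N * g z"
      by (simp add: algebra_simps)
    moreover have "of_int c * (of_int N * g x) + of_int N * g z \<in> \<int>"
      using calculation(1) step.IH by (intro Ints_add) (auto intro: Ints_mult)
    ultimately show ?case by simp
  qed
  then have "of_int N * q ^ k \<in> \<int>" for k
    using F(2)[of k] g_rat[of "q ^ k"] by (metis of_rat_power)
  moreover have "N > 0" unfolding N_def using den by (simp add: prod_pos)
  ultimately show ?thesis by blast
qed

lemma prime_dvd_const_coeff_of_factor:
  fixes f :: "complex \<Rightarrow> int poly" and p D :: int
  assumes p: "prime p" "p dvd D"
    and sq: "(prod_list \<beta>s)\<^sup>2 = of_int D" and "D \<noteq> 0"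
    and f: "\<And>\<beta>. \<beta> \<in> set \<beta>s \<Longrightarrow> poly (cpoly (f \<beta>)) \<beta> = 0 \<and> coeff (f \<beta>) 0 \<noteq> 0"
  shows "\<exists>\<beta>\<in>set \<beta>s. p dvd coeff (f \<beta>) 0"
proof (rule ccontr)
  assume "\<not> ?thesis"
  then have np: "\<And>\<beta>. \<beta> \<in> set \<beta>s \<Longrightarrow> \<not> p dvd coeff (f \<beta>) 0" by blast
  define m where "m = (\<Prod>\<beta>\<leftarrow>\<beta>s. coeff (f \<beta>) 0)"
  have m: "\<not> p dvd m"
    using np unfolding m_def
    by (induction \<beta>s) (use p in \<open>auto simp: prime_dvd_mult_iff\<close>)
  have nz: "\<beta> \<noteq> 0" if "\<beta> \<in> set \<beta>s" for \<beta>
  proof -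
    have "prod_list \<beta>s \<noteq> 0" using sq \<open>D \<noteq> 0\<close> by auto
    then show ?thesis using that by (auto simp: prod_list_zero_iff)
  qed
  have eq: "(\<Prod>\<beta>\<leftarrow>\<beta>s. of_int (coeff (f \<beta>) 0) / \<beta>) = of_int m / prod_list \<beta>s"
    unfolding m_def by (induction \<beta>s) auto
  have "powers_fin_gen (of_int m / prod_list \<beta>s)"
    unfolding eq[symmetric]
    by (rule powers_fin_gen_prod_list) (use f nz in \<open>auto intro: powers_fin_gen_const_coeff_div_root\<close>)
  \<comment> \<open>The square of this algebraic integer is the rational number
    \<open>m\<^sup>2 / D\<close>.\<close>
  then have "powers_fin_gen ((of_int m / prod_list \<beta>s) * (of_int m / prod_list \<beta>s))"
    by (intro powers_fin_gen_mult)
  also have "(of_int m / prod_list \<beta>s) * (of_int m / prod_list \<beta>s) = of_rat (of_int (m\<^sup>2) / of_int D)"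
    using sq by (simp add: of_rat_divide of_rat_mult power2_eq_square)
  finally obtain N :: int where N: "N > 0" "\<And>k. of_int N * (of_int (m\<^sup>2) / of_int D :: rat) ^ k \<in> \<int>"
    using powers_fin_gen_rat_bounded_denominator by blast
  \<comment> \<open>Clearing denominators gives \<open>N * (m\<^sup>2) ^ k = z * D ^ k\<close>; as
    \<open>p\<close> divides \<open>D\<close> but not \<open>m\<close>, all of \<open>p ^ k\<close>
    goes into \<open>N\<close>.\<close>
  have dvd: "p ^ k dvd N" for k
  proof -
    obtain z :: int where "of_int N * (of_int (m\<^sup>2) / of_int D :: rat) ^ k = of_int z"
      using N(2)[of k] by (auto elim: Ints_cases)
    then have "of_int (N * (m\<^sup>2) ^ k) = (of_int (z * D ^ k) :: rat)"
      using \<open>D \<noteq> 0\<close> by (simp add: power_divide field_simps)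
    then have "N * (m\<^sup>2) ^ k = z * D ^ k" by (simp only: of_int_eq_iff)
    then have "p ^ k dvd N * (m\<^sup>2) ^ k" using p(2) by (simp add: dvd_power_same)
    moreover have "coprime (p ^ k) ((m\<^sup>2) ^ k)"
      using m p(1) by (simp add: prime_imp_coprime)
    ultimately show ?thesis by (simp add: coprime_dvd_mult_left_iff)
  qed
  \<comment> \<open>The exponent \<open>k = nat N\<close> is already too large, because
    \<open>N < 2 ^ nat N \<le> p ^ nat N\<close>.\<close>
  have "2 \<le> p" using p(1) by (rule prime_ge_2_int)
  then have "2 ^ nat N \<le> p ^ nat N" by (intro power_mono) auto
  also have "p ^ nat N \<le> N" using dvd[of "nat N"] N(1) by (rule zdvd_imp_le)
  also have "N = int (nat N)" using N(1) by simp
  also have "\<dots> < 2 ^ nat N" using less_exp[of "nat N"] by (metis of_nat_less_iff of_nat_numeral of_nat_power)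
  finally show False using N(1) by simp
qed

section \<open>Mahler measures of integer polynomials\<close>

lemma lead_coeff_cpoly: "lead_coeff (cpoly f) = of_int (lead_coeff f)"
  by (simp add: degree_map_poly coeff_map_poly)

lemma cpoly_eq_0_iff: "cpoly f = 0 \<longleftrightarrow> f = 0"
  by (metis lead_coeff_cpoly leading_coeff_0_iff of_int_eq_0_iff)

lemma is_min_int_poly_min_int_poly: "algebraic \<beta> \<Longrightarrow> is_min_int_poly \<beta> (min_int_poly \<beta>)"
  unfolding min_int_poly_def by (rule theI') (rule ex1_is_min_int_poly)

lemma algebraic_if_root: "g \<noteq> 0 \<Longrightarrow> poly (cpoly g) \<beta> = 0 \<Longrightarrow> algebraic \<beta>"
  by (rule algebraicI[of "cpoly g"]) (auto simp: coeff_map_poly cpoly_eq_0_iff)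

text \<open>Some irreducible factor of \<open>g\<close> vanishes at \<open>\<beta>\<close>; up to
  sign, uniqueness identifies it with the minimal polynomial.\<close>

lemma min_int_poly_dvd:
  assumes g: "g \<noteq> 0" "poly (cpoly g) \<beta> = 0"
  shows "min_int_poly \<beta> dvd g"
proof -
  have alg: "algebraic \<beta>" using g by (rule algebraic_if_root)
  obtain h where h: "irreducible h" "h dvd g" "poly (cpoly h) \<beta> = 0"
    using ex_irreducible_root_factor[OF g] by blast
  have eq: "min_int_poly \<beta> = f" if "is_min_int_poly \<beta> f" for f
    using ex1_is_min_int_poly[OF alg] is_min_int_poly_min_int_poly[OF alg] that by blast
  show ?thesis
  proof (cases "lead_coeff h > 0")
    case True
    then have "min_int_poly \<beta> = h" using h by (intro eq) (simp add: is_min_int_poly_def)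
    then show ?thesis using h by simp
  next
    case False
    then have "lead_coeff (- h) > 0" using h(1) by (auto simp: less_le)
    moreover have "cpoly (- h) = - cpoly h" by (rule poly_eqI) (simp add: coeff_map_poly)
    moreover have "irreducible (- h)"
      using h(1) irreducible_mult_unit_left[of "- 1" h] by simp
    ultimately have "min_int_poly \<beta> = - h"
      using h by (intro eq) (simp add: is_min_int_poly_def)
    then show ?thesis using h by simp
  qed
qed

text \<open>Otherwise \<open>X\<close> could be cancelled, and the minimal polynomial would divide a
  non-zero polynomial of smaller degree.\<close>

lemma coeff_0_min_int_poly_nonzero:
  assumes "algebraic \<beta>" "\<beta> \<noteq> 0"
  shows "coeff (min_int_poly \<beta>) 0 \<noteq> 0"
proof
  define f where "f = min_int_poly \<beta>"
  have f: "f \<noteq> 0" "poly (cpoly f) \<beta> = 0"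
    using is_min_int_poly_min_int_poly[OF assms(1)] by (auto simp: f_def is_min_int_poly_def)
  assume "coeff (min_int_poly \<beta>) 0 = 0"
  then obtain g where g: "f = pCons 0 g" unfolding f_def by (cases "min_int_poly \<beta>") auto
  have "poly (cpoly g) \<beta> = 0" using f(2) assms(2) by (simp add: g map_poly_pCons)
  moreover have "g \<noteq> 0" using f(1) g by auto
  ultimately have "f dvd g" unfolding f_def by (intro min_int_poly_dvd)
  then have "degree f \<le> degree g" using \<open>g \<noteq> 0\<close> by (rule dvd_imp_degree_le)
  then show False using g \<open>g \<noteq> 0\<close> by simp
qed

lemma log_mahler_mult:
  assumes "f \<noteq> 0" "g \<noteq> 0"
  shows "log_mahler (f * g) = log_mahler f + log_mahler g"
  using assms by (simp add: log_mahler_def proots_mult lead_coeff_mult norm_mult ln_mult)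

lemma ln_lead_coeff_nonneg: "f \<noteq> 0 \<Longrightarrow> 0 \<le> ln (cmod (lead_coeff (cpoly f)))"
proof -
  assume "f \<noteq> 0"
  then have "1 \<le> \<bar>lead_coeff f\<bar>" using leading_coeff_0_iff[of f] by linarith
  then have "1 \<le> cmod (lead_coeff (cpoly f))" unfolding lead_coeff_cpoly norm_of_int by linarith
  then show ?thesis by simp
qed

lemma sum_mset_max_nonneg: "0 \<le> (\<Sum>x\<in>#A. max 0 (f x :: real))"
  by (induction A) auto

lemma log_mahler_cpoly_nonneg: "f \<noteq> 0 \<Longrightarrow> 0 \<le> log_mahler (cpoly f)"
  unfolding log_mahler_def
  by (intro add_nonneg_nonneg ln_lead_coeff_nonneg sum_mset_max_nonneg)

lemma log_mahler_alg_nonneg: "algebraic \<beta> \<Longrightarrow> 0 \<le> log_mahler_alg \<beta>"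
  unfolding log_mahler_alg_def
  using is_min_int_poly_min_int_poly[of \<beta>]
  by (intro log_mahler_cpoly_nonneg) (auto simp: is_min_int_poly_def)

text \<open>The cofactor of the minimal polynomial has non-negative measure. Upper bounds can thus
  be read off any vanishing integer polynomial, without proving it irreducible.\<close>

lemma log_mahler_alg_le:
  assumes g: "g \<noteq> 0" "poly (cpoly g) \<beta> = 0"
  shows "log_mahler_alg \<beta> \<le> log_mahler (cpoly g)"
proof -
  obtain h where h: "g = min_int_poly \<beta> * h" using min_int_poly_dvd[OF g] by (elim dvdE)
  then have "min_int_poly \<beta> \<noteq> 0" "h \<noteq> 0" using g(1) by auto
  then show ?thesis
    using log_mahler_cpoly_nonneg[of h]
    by (simp add: h cpoly_mult log_mahler_mult cpoly_eq_0_iff log_mahler_alg_def)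
qed

text \<open>Up to sign, the constant coefficient is the leading one times the product of the roots,
  and \<open>ln\<close> is at most its positive part at each root.\<close>

lemma ln_coeff_0_le_log_mahler:
  assumes "coeff f 0 \<noteq> 0"
  shows "ln (cmod (coeff f 0)) \<le> log_mahler f"
proof -
  have f: "f \<noteq> 0" using assms by auto
  have "coeff f 0 = poly (smult (lead_coeff f) (\<Prod>x\<in>#proots f. [:-x, 1:])) 0"
    unfolding complex_poly_decompose_multiset by (rule poly_0_coeff_0[symmetric])
  also have "\<dots> = lead_coeff f * (\<Prod>x\<in>#proots f. - x)"
    by (simp add: poly_prod_mset image_mset.compositionality o_def)
  finally have c: "coeff f 0 = lead_coeff f * (\<Prod>x\<in>#proots f. - x)" .
  have nz: "x \<noteq> 0" if "x \<in># proots f" for x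
    using that f assms by (auto simp: poly_0_coeff_0)
  have *: "cmod (\<Prod>x\<in>#A. - x) > 0 \<and>
      ln (cmod (\<Prod>x\<in>#A. - x)) \<le> (\<Sum>x\<in>#A. max 0 (ln (cmod x)))"
    if "\<And>x. x \<in># A \<Longrightarrow> x \<noteq> 0" for A :: "complex multiset"
    using that
  proof (induction A)
    case (add y A)
    then have "y \<noteq> 0" "cmod (\<Prod>x\<in>#A. - x) > 0" by auto
    then show ?case using add by (auto simp: norm_mult ln_mult)
  qed simp
  have "0 < cmod (\<Prod>x\<in>#proots f. - x)"
    and le: "ln (cmod (\<Prod>x\<in>#proots f. - x)) \<le> (\<Sum>x\<in>#proots f. max 0 (ln (cmod x)))"
    using *[of "proots f"] nz by blast+
  moreover have "cmod (lead_coeff f) > 0" using f by simp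
  ultimately have "ln (cmod (coeff f 0)) = ln (cmod (lead_coeff f)) + ln (cmod (\<Prod>x\<in>#proots f. - x))"
    unfolding c norm_mult by (simp add: ln_mult)
  then show ?thesis
    using le unfolding log_mahler_def by linarith
qed

lemma log_mahler_quadratic:
  assumes "a \<noteq> 0"
  shows "log_mahler (smult a ([:-r, 1:] * [:-s, 1:])) =
    ln (cmod a) + max 0 (ln (cmod r)) + max 0 (ln (cmod s))"
proof -
  have "proots (smult a ([:-r, 1:] * [:-s, 1:])) = {#r, s#}"
    using assms by (simp add: proots_mult del: mult_pCons_left mult_pCons_right)
  moreover have "lead_coeff (smult a ([:-r, 1:] * [:-s, 1:])) = a"
    unfolding lead_coeff_smult lead_coeff_mult by simp
  ultimately show ?thesis unfolding log_mahler_def by simp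
qed

text \<open>Both roots of \<open>n * X\<^sup>2 - m\<close> have modulus \<open>s\<close>, and
  \<open>ln n + 2 * max 0 (ln s)\<close> is the stated maximum because
  \<open>2 * ln s = ln m - ln n\<close>.\<close>

lemma sqrt_quotient_mahler:
  assumes "m > 0" "n > 0"
  shows "algebraic (complex_of_real (sqrt (real m / real n)))"
    and "log_mahler_alg (complex_of_real (sqrt (real m / real n))) \<le> max (ln (real m)) (ln (real n))"
proof -
  define s where "s = sqrt (real m / real n)"
  have s: "s > 0" "s * s = real m / real n" using assms by (auto simp: s_def)
  define g :: "int poly" where "g = [:- int m, 0, int n:]"
  have "complex_of_real s * complex_of_real s = of_nat m / of_nat n"
    using s(2) by (metis of_real_divide of_real_mult of_real_of_nat_eq)
  then have ss: "of_nat n * (complex_of_real s * complex_of_real s) = of_nat m"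
    using assms by simp
  have g: "g \<noteq> 0" using assms by (simp add: g_def)
  have "cpoly g = smult (of_nat n) ([:- of_real s, 1:] * [:- (- of_real s), 1:])"
    using ss by (simp add: g_def map_poly_pCons)
  then have lm: "log_mahler (cpoly g) = ln (real n) + max 0 (ln s) + max 0 (ln s)"
    using log_mahler_quadratic[of "of_nat n" "of_real s" "- of_real s"] assms s(1) by simp
  have "2 * ln s = ln (s * s)" using s(1) by (simp add: ln_mult)
  also have "\<dots> = ln (real m) - ln (real n)" using assms by (simp add: s(2) ln_div)
  finally have "log_mahler (cpoly g) = max (ln (real m)) (ln (real n))"
    unfolding lm by linarith
  moreover have root: "poly (cpoly g) (of_real s) = 0"
    using ss by (simp add: g_def map_poly_pCons algebra_simps)
  ultimately show "log_mahler_alg (complex_of_real (sqrt (real m / real n))) \<le>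
      max (ln (real m)) (ln (real n))"
    using log_mahler_alg_le[OF g] by (simp add: s_def)
  show "algebraic (complex_of_real (sqrt (real m / real n)))"
    using algebraic_if_root[OF g root] by (simp add: s_def)
qed

lemma log_mahler_alg_of_nat_le:
  assumes "n > 0"
  shows "log_mahler_alg (of_nat n) \<le> ln (real n)"
proof -
  define g :: "int poly" where "g = [:- int n, 1:]"
  have g: "cpoly g = [:- of_nat n, 1:]" "g \<noteq> 0" by (simp_all add: g_def map_poly_pCons)
  have "log_mahler (cpoly g) = ln (real n)"
    using assms by (simp add: g log_mahler_def)
  then show ?thesis using log_mahler_alg_le[of g "of_nat n"] g by simp
qed

section \<open>The lower bound\<close>

text \<open>In \<open>x powr t = x * x powr (t - 1)\<close> the second factor is at most
  \<open>M powr (t - 1)\<close>. Later \<open>M\<close> is the measure of one factor and the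
  \<open>x i\<close> are the logarithms of the primes assigned to it.\<close>

lemma sum_powr_le_powr:
  fixes x :: "'a \<Rightarrow> real"
  assumes "finite S" "\<And>i. i \<in> S \<Longrightarrow> 0 \<le> x i" "sum x S \<le> M" "t \<ge> 1"
  shows "(\<Sum>i\<in>S. x i powr t) \<le> M powr t"
proof -
  have M: "0 \<le> M" using assms(2,3) sum_nonneg[of S x] by force
  have "(\<Sum>i\<in>S. x i powr t) \<le> (\<Sum>i\<in>S. x i * M powr (t - 1))"
  proof (rule sum_mono)
    fix i assume i: "i \<in> S"
    have "x i \<le> sum x S" using i assms(1,2) by (intro member_le_sum) auto
    then have "x i powr (t - 1) \<le> M powr (t - 1)"
      using assms i by (intro powr_mono2) auto
    then show "x i powr t \<le> x i * M powr (t - 1)"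
      using powr_mult_base[of "x i" "t - 1"] assms(2)[OF i]
        mult_left_mono[of "x i powr (t - 1)" "M powr (t - 1)" "x i"] by simp
  qed
  also have "\<dots> \<le> M * M powr (t - 1)"
    unfolding sum_distrib_right[symmetric] using assms(3) by (intro mult_right_mono) auto
  also have "\<dots> = M powr t" using powr_mult_base[OF M, of "t - 1"] by simp
  finally show ?thesis .
qed

text \<open>Here the second factor is bounded by \<open>P powr (t - 1)\<close>; \<open>P < M\<close>
  and \<open>t > 1\<close> make the last comparison strict.\<close>

lemma sum_powr_less_powr:
  fixes x :: "'a \<Rightarrow> real"
  assumes "\<And>i. i \<in> S \<Longrightarrow> 0 \<le> x i \<and> x i \<le> P" "sum x S \<le> M" "0 \<le> P" "P < M" "t > 1"
  shows "(\<Sum>i\<in>S. x i powr t) < M powr t"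
proof -
  have "(\<Sum>i\<in>S. x i powr t) \<le> (\<Sum>i\<in>S. x i * P powr (t - 1))"
  proof (rule sum_mono)
    fix i assume i: "i \<in> S"
    have "x i powr (t - 1) \<le> P powr (t - 1)"
      using assms(1)[OF i] assms(5) by (intro powr_mono2) auto
    then show "x i powr t \<le> x i * P powr (t - 1)"
      using powr_mult_base[of "x i" "t - 1"] assms(1)[OF i]
        mult_left_mono[of "x i powr (t - 1)" "P powr (t - 1)" "x i"] by simp
  qed
  also have "\<dots> \<le> M * P powr (t - 1)"
    unfolding sum_distrib_right[symmetric] using assms(2) by (intro mult_right_mono) auto
  also have "\<dots> < M * M powr (t - 1)"
    using assms by (intro mult_strict_left_mono powr_less_mono2) auto
  also have "\<dots> = M powr t" using powr_mult_base[of M "t - 1"] assms by simp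
  finally show ?thesis .
qed

lemma prod_primes_dvd:
  fixes n :: nat
  assumes "finite S" "\<And>q. q \<in> S \<Longrightarrow> prime q \<and> q dvd n"
  shows "\<Prod>S dvd n"
  using assms
proof (induction S)
  case (insert q S)
  have "coprime q (\<Prod>S)"
    using insert by (intro prod_coprime_right) (auto intro!: primes_coprime)
  then show ?case using insert by (auto intro: divides_mult)
qed simp

text \<open>The product of distinct primes dividing the non-zero constant coefficient is at most its
  absolute value, whose logarithm the Mahler measure bounds.\<close>

lemma sum_ln_primes_le_log_mahler_alg:
  assumes \<beta>: "algebraic \<beta>" "\<beta> \<noteq> 0"
    and S: "finite S" "\<And>q. q \<in> S \<Longrightarrow> prime q \<and> int q dvd coeff (min_int_poly \<beta>) 0"
  shows "(\<Sum>q\<in>S. ln (real q)) \<le> log_mahler_alg \<beta>"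
proof -
  define c where "c = coeff (min_int_poly \<beta>) 0"
  have c: "c \<noteq> 0" using coeff_0_min_int_poly_nonzero[OF \<beta>] by (simp add: c_def)
  have "\<Prod>S dvd nat \<bar>c\<bar>"
    using S by (intro prod_primes_dvd) (auto simp: c_def nat_abs_dvd_iff[symmetric] int_dvd_int_iff[symmetric])
  then have "\<Prod>S \<le> nat \<bar>c\<bar>" using c by (intro dvd_imp_le) auto
  then have le: "real (\<Prod>S) \<le> real_of_int \<bar>c\<bar>" by linarith
  have pos: "0 < q" if "q \<in> S" for q using S(2)[OF that] prime_gt_0_nat by blast
  have "(\<Sum>q\<in>S. ln (real q)) = ln (real (\<Prod>S))"
    using S(1) pos by (simp add: ln_prod)
  also have "\<dots> \<le> ln (real_of_int \<bar>c\<bar>)"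
    using le S(1) pos by (intro ln_mono) (auto intro!: prod_pos)
  also have "\<dots> = ln (cmod (coeff (cpoly (min_int_poly \<beta>)) 0))"
    by (simp add: coeff_map_poly c_def)
  also have "\<dots> \<le> log_mahler (cpoly (min_int_poly \<beta>))"
    using c by (intro ln_coeff_0_le_log_mahler) (simp add: coeff_map_poly c_def)
  finally show ?thesis by (simp add: log_mahler_alg_def)
qed

text \<open>The common value of \<open>M\<^sub>t(\<surd>D)\<close> for all \<open>D = \<Prod>Q\<close>, whether or not it is attained in \<open>\<rat>(\<surd>D)\<close>.\<close>

definition primes_norm :: "ereal \<Rightarrow> nat set \<Rightarrow> real" where
  "primes_norm t Q =
     (if t = \<infinity> then ln (real (Max Q))
      else (\<Sum>q\<in>Q. ln (real q) powr real_of_ereal t) powr (1 / real_of_ereal t))"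

section \<open>Factorizations of a square root of a product of distinct primes\<close>

context
  fixes Q :: "nat set" and \<delta> :: complex
  assumes fin: "finite Q" and ne: "Q \<noteq> {}" and all_prime: "\<forall>q\<in>Q. prime q"
    and \<delta>: "\<delta>\<^sup>2 = of_nat (\<Prod>Q)"
begin

lemma prime_if_mem: "q \<in> Q \<Longrightarrow> prime q"
  using all_prime by blast

lemma ln_prime_bounds:
  assumes "q \<in> Q"
  shows "0 \<le> ln (real q)" "ln (real q) \<le> ln (real (Max Q))"
proof -
  have "1 \<le> q" using prime_if_mem[OF assms] prime_ge_1_nat by blast
  then show "0 \<le> ln (real q)" by simp
  show "ln (real q) \<le> ln (real (Max Q))" using \<open>1 \<le> q\<close> assms fin by (intro ln_mono) auto
qed

text \<open>Primes are assigned to positions rather than values, to match the sum over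
  \<open>\<beta>s\<close> when entries repeat.\<close>

lemma prime_assignment:
  assumes "is_factorization \<delta> \<beta>s"
  obtains n where "\<And>q. q \<in> Q \<Longrightarrow> n q < length \<beta>s \<and> int q dvd coeff (min_int_poly (\<beta>s ! n q)) 0"
proof -
  have "\<exists>i. i < length \<beta>s \<and> int q dvd coeff (min_int_poly (\<beta>s ! i)) 0" if q: "q \<in> Q" for q
  proof -
    have "\<exists>\<beta>\<in>set \<beta>s. int q dvd coeff (min_int_poly \<beta>) 0"
    proof (rule prime_dvd_const_coeff_of_factor)
      show "prime (int q)" using prime_if_mem[OF q] by simp
      show "int q dvd int (\<Prod>Q)" using q fin by (simp only: int_dvd_int_iff) (rule dvd_prodI)
      show "(prod_list \<beta>s)\<^sup>2 = of_int (int (\<Prod>Q))"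
        using \<delta> assms by (simp add: is_factorization_def)
      show "int (\<Prod>Q) \<noteq> 0" using prime_if_mem[of 0] fin by (auto simp: prod_zero_iff)
      show "poly (cpoly (min_int_poly \<beta>)) \<beta> = 0 \<and> coeff (min_int_poly \<beta>) 0 \<noteq> 0" if "\<beta> \<in> set \<beta>s" for \<beta>
        using that assms is_min_int_poly_min_int_poly[of \<beta>] coeff_0_min_int_poly_nonzero[of \<beta>]
        by (auto simp: is_factorization_def is_min_int_poly_def)
    qed
    then show ?thesis by (auto simp: in_set_conv_nth)
  qed
  then show thesis using that by metis
qed

lemma sum_powr_bounds:
  fixes t :: real
  assumes fact: "is_factorization \<delta> \<beta>s" and t: "t > 1"
  shows "(\<Sum>q\<in>Q. ln (real q) powr t) \<le> (\<Sum>x\<leftarrow>\<beta>s. log_mahler_alg x powr t)"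
    and "\<beta> \<in> set \<beta>s \<Longrightarrow> ln (real (Max Q)) < log_mahler_alg \<beta> \<Longrightarrow>
      (\<Sum>q\<in>Q. ln (real q) powr t) < (\<Sum>x\<leftarrow>\<beta>s. log_mahler_alg x powr t)"
proof -
  obtain n where n:
    "\<And>q. q \<in> Q \<Longrightarrow> n q < length \<beta>s \<and> int q dvd coeff (min_int_poly (\<beta>s ! n q)) 0"
    using prime_assignment[OF fact] by blast
  \<comment> \<open>The sets \<open>S i\<close> partition \<open>Q\<close>; a position without
    primes contributes an empty sum.\<close>
  define S where "S = (\<lambda>i. {q \<in> Q. n q = i})"
  have S: "finite (S i)" for i using fin by (simp add: S_def)
  have lhs: "(\<Sum>q\<in>Q. ln (real q) powr t) = (\<Sum>i<length \<beta>s. \<Sum>q\<in>S i. ln (real q) powr t)"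
    unfolding S_def using fin n by (intro sum.group[symmetric]) auto
  have rhs: "(\<Sum>x\<leftarrow>\<beta>s. log_mahler_alg x powr t) = (\<Sum>i<length \<beta>s. log_mahler_alg (\<beta>s ! i) powr t)"
    by (simp add: sum_list_sum_nth atLeast0LessThan)
  have sum_ln: "(\<Sum>q\<in>S i. ln (real q)) \<le> log_mahler_alg (\<beta>s ! i)" if "i < length \<beta>s" for i
    using fact that S n prime_if_mem
    by (intro sum_ln_primes_le_log_mahler_alg) (auto simp: S_def is_factorization_def)
  have le: "(\<Sum>q\<in>S i. ln (real q) powr t) \<le> log_mahler_alg (\<beta>s ! i) powr t"
    if "i < length \<beta>s" for i
    using S ln_prime_bounds(1) sum_ln[OF that] t
    by (intro sum_powr_le_powr) (auto simp: S_def)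
  show "(\<Sum>q\<in>Q. ln (real q) powr t) \<le> (\<Sum>x\<leftarrow>\<beta>s. log_mahler_alg x powr t)"
    unfolding lhs rhs using le by (intro sum_mono) auto
  assume "\<beta> \<in> set \<beta>s" and gt: "ln (real (Max Q)) < log_mahler_alg \<beta>"
  then obtain j where j: "j < length \<beta>s" "\<beta>s ! j = \<beta>" by (auto simp: in_set_conv_nth)
  have "0 \<le> ln (real (Max Q))" using ln_prime_bounds(1) fin ne by simp
  \<comment> \<open>Strictness at position \<open>j\<close> holds even if no prime is assigned to
    it.\<close>
  then have "(\<Sum>q\<in>S j. ln (real q) powr t) < log_mahler_alg (\<beta>s ! j) powr t"
    using ln_prime_bounds sum_ln[OF j(1)] gt t j
    by (intro sum_powr_less_powr[where P = "ln (real (Max Q))"]) (auto simp: S_def)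
  then show "(\<Sum>q\<in>Q. ln (real q) powr t) < (\<Sum>x\<leftarrow>\<beta>s. log_mahler_alg x powr t)"
    unfolding lhs rhs using le j by (intro sum_strict_mono_ex1) auto
qed

lemma primes_norm_le_mahler_lt:
  assumes fact: "is_factorization \<delta> \<beta>s" and t: "t > 1"
  shows "primes_norm t Q \<le> mahler_lt t \<beta>s"
proof (cases t)
  case (real r)
  then show ?thesis
    using sum_powr_bounds(1)[OF fact, of r] t
    by (auto simp: primes_norm_def mahler_lt_def intro!: powr_mono2 sum_nonneg)
next
  case PInf
  obtain n where n:
    "\<And>q. q \<in> Q \<Longrightarrow> n q < length \<beta>s \<and> int q dvd coeff (min_int_poly (\<beta>s ! n q)) 0"
    using prime_assignment[OF fact] by blast
  \<comment> \<open>For \<open>t = \<infinity>\<close> the factor that receives the largest prime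
    alone gives the bound.\<close>
  define \<beta> where "\<beta> = \<beta>s ! n (Max Q)"
  have "Max Q \<in> Q" using fin ne by simp
  then have \<beta>: "\<beta> \<in> set \<beta>s" "int (Max Q) dvd coeff (min_int_poly \<beta>) 0" "prime (Max Q)"
    using n prime_if_mem by (auto simp: \<beta>_def)
  then have "(\<Sum>q\<in>{Max Q}. ln (real q)) \<le> log_mahler_alg \<beta>"
    using fact by (intro sum_ln_primes_le_log_mahler_alg) (auto simp: is_factorization_def)
  also have "\<dots> \<le> Max (log_mahler_alg ` set \<beta>s)" using \<beta>(1) by (intro Max_ge) auto
  finally show ?thesis using PInf by (simp add: primes_norm_def mahler_lt_def)
qed (use t in auto)

text \<open>For finite \<open>t\<close> a larger measure would make the lower bound strict; for
  \<open>t = \<infinity>\<close> the claim is read off the maximum. The conclusion no longer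
  involves \<open>t\<close>, so the converse treats all \<open>t\<close> alike.\<close>

lemma log_mahler_alg_le_if_mahler_lt_le:
  assumes fact: "is_factorization \<delta> \<beta>s" and t: "t > 1"
    and le: "mahler_lt t \<beta>s \<le> primes_norm t Q" and \<beta>: "\<beta> \<in> set \<beta>s"
  shows "log_mahler_alg \<beta> \<le> ln (real (Max Q))"
proof (cases t)
  case (real r)
  show ?thesis
  proof (rule ccontr)
    assume "\<not> ?thesis"
    then have "(\<Sum>q\<in>Q. ln (real q) powr r) < (\<Sum>x\<leftarrow>\<beta>s. log_mahler_alg x powr r)"
      using sum_powr_bounds(2)[OF fact, of r \<beta>] t \<beta> real by auto
    then have "primes_norm t Q < mahler_lt t \<beta>s"
      using t real
      by (auto simp: primes_norm_def mahler_lt_def intro!: powr_less_mono2 sum_nonneg)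
    then show False using le by simp
  qed
next
  case PInf
  have "log_mahler_alg \<beta> \<le> Max (log_mahler_alg ` set \<beta>s)" using \<beta> by (intro Max_ge) auto
  then show ?thesis using le PInf by (simp add: primes_norm_def mahler_lt_def)
qed (use t in auto)

text \<open>This serves both the square roots of the primes, which show that the lower bound is the
  infimum, and the points of the theorem.\<close>

lemma mahler_lt_map_le_primes_norm:
  assumes qs: "distinct qs" "set qs = Q" and t: "t > 1"
    and h: "\<And>q. q \<in> Q \<Longrightarrow> algebraic (h q) \<and> log_mahler_alg (h q) \<le> ln (real q)"
  shows "mahler_lt t (map h qs) \<le> primes_norm t Q"
proof (cases t)
  case (real r)
  have "(\<Sum>x\<leftarrow>map h qs. log_mahler_alg x powr r) = (\<Sum>q\<in>Q. log_mahler_alg (h q) powr r)"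
    using qs by (simp add: sum_list_distinct_conv_sum_set o_def)
  also have "\<dots> \<le> (\<Sum>q\<in>Q. ln (real q) powr r)"
    using h log_mahler_alg_nonneg t real by (intro sum_mono powr_mono2) auto
  finally show ?thesis using t real
    by (auto simp: primes_norm_def mahler_lt_def intro!: powr_mono2 sum_list_nonneg)
next
  case PInf
  have "log_mahler_alg x \<le> ln (real (Max Q))" if "x \<in> h ` Q" for x
    using that h ln_prime_bounds(2) by fastforce
  then show ?thesis using PInf qs fin ne
    by (auto simp: primes_norm_def mahler_lt_def)
qed (use t in auto)

lemma metric_mahler_eq_primes_norm:
  assumes "is_factorization \<delta> \<beta>s" "mahler_lt t \<beta>s \<le> primes_norm t Q" "t > 1"
  shows "metric_mahler t \<delta> = primes_norm t Q"
  unfolding metric_mahler_def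
proof (rule cInf_eq_minimum)
  have "mahler_lt t \<beta>s = primes_norm t Q" using primes_norm_le_mahler_lt assms by (intro antisym)
  then show "primes_norm t Q \<in> {mahler_lt t \<beta>s |\<beta>s. is_factorization \<delta> \<beta>s}"
    using assms(1) by (intro CollectI exI[of _ \<beta>s]) simp
  show "primes_norm t Q \<le> x" if "x \<in> {mahler_lt t \<beta>s |\<beta>s. is_factorization \<delta> \<beta>s}" for x
    using that primes_norm_le_mahler_lt assms(3) by blast
qed

end

section \<open>Factorizations in a real quadratic field\<close>

text \<open>In lowest terms \<open>r = u / v\<close>, the square of \<open>v\<close> divides
  \<open>D\<close>, so \<open>v = 1\<close>. This yields the irrationality of \<surd>D and the
  divisibility of discriminants by \<open>D\<close>.\<close>

lemma squarefree_mult_square_int: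
  fixes r :: rat and D n :: int
  assumes "squarefree D" "r\<^sup>2 * of_int D = of_int n"
  shows "\<exists>k. r = of_int k \<and> n = k\<^sup>2 * D"
proof -
  obtain u v where uv: "quotient_of r = (u, v)" by (cases "quotient_of r")
  then have v: "v > 0" and cop: "coprime u v" and r: "r = of_int u / of_int v"
    using quotient_of_denom_pos quotient_of_coprime quotient_of_div by blast+
  have "of_int (u\<^sup>2 * D) = (of_int (n * v\<^sup>2) :: rat)"
    using assms(2) v by (simp add: r power_divide field_simps)
  then have "u\<^sup>2 * D = n * v\<^sup>2" by (simp only: of_int_eq_iff)
  then have "v\<^sup>2 dvd u\<^sup>2 * D" by simp
  moreover have "coprime (v\<^sup>2) (u\<^sup>2)" using cop by (simp add: coprime_commute)
  ultimately have "v\<^sup>2 dvd D" by (simp add: coprime_dvd_mult_right_iff)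
  then have "v dvd 1" using assms(1) squarefreeD by blast
  then have "v = 1" using v by auto
  then show ?thesis using r \<open>u\<^sup>2 * D = n * v\<^sup>2\<close> by auto
qed

text \<open>The \<open>p\<close>-adic valuation of \<open>q \<noteq> 0\<close> is even: \<open>u / v\<close> and \<open>u * v\<close> have valuations of the same parity.\<close>

definition even_val :: "int \<Rightarrow> rat \<Rightarrow> bool" where
  "even_val p q \<longleftrightarrow> (\<exists>u v. u \<noteq> 0 \<and> v \<noteq> 0 \<and> q = of_int u / of_int v \<and> even (multiplicity p (u * v)))"

lemma even_val_mult:
  assumes "prime p" "even_val p q" "even_val p r"
  shows "even_val p (q * r)"
proof -
  obtain u v u' v' where *: "u \<noteq> 0" "v \<noteq> 0" "q = of_int u / of_int v" "even (multiplicity p (u * v))"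
    "u' \<noteq> 0" "v' \<noteq> 0" "r = of_int u' / of_int v'" "even (multiplicity p (u' * v'))"
    using assms unfolding even_val_def by blast
  have "multiplicity p ((u * u') * (v * v')) = multiplicity p ((u * v) * (u' * v'))"
    by (simp add: mult_ac)
  also have "\<dots> = multiplicity p (u * v) + multiplicity p (u' * v')"
    using * assms(1) by (intro prime_elem_multiplicity_mult_distrib) auto
  finally have "even (multiplicity p ((u * u') * (v * v')))" using * by simp
  then show ?thesis unfolding even_val_def using *
    by (intro exI[of _ "u * u'"] exI[of _ "v * v'"]) auto
qed

lemma even_val_square:
  assumes "prime p" "q \<noteq> 0"
  shows "even_val p (q\<^sup>2)"
proof -
  obtain u v where uv: "quotient_of q = (u, v)" by (cases "quotient_of q")
  then have v: "v > 0" and q: "q = of_int u / of_int v"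
    using quotient_of_denom_pos quotient_of_div by blast+
  then have "u \<noteq> 0" using assms(2) by auto
  have "multiplicity p (u\<^sup>2 * v\<^sup>2) = multiplicity p ((u * v)\<^sup>2)"
    by (simp add: power_mult_distrib)
  also have "\<dots> = 2 * multiplicity p (u * v)"
    using assms(1) \<open>u \<noteq> 0\<close> v by (intro prime_elem_multiplicity_power_distrib) auto
  finally show ?thesis unfolding even_val_def using \<open>u \<noteq> 0\<close> v q
    by (intro exI[of _ "u\<^sup>2"] exI[of _ "v\<^sup>2"]) (auto simp: power_divide)
qed

text \<open>Any representation \<open>u / v\<close> of \<open>- D\<close> has
  \<open>u * v = - D * v\<^sup>2\<close>, where \<open>p\<close> has odd multiplicity because it
  occurs exactly once in \<open>D\<close>.\<close>

lemma not_even_val_minus_squarefree: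
  assumes "prime p" "p dvd D" "squarefree D"
  shows "\<not> even_val p (- of_int D)"
proof
  assume "even_val p (- of_int D)"
  then obtain u v where uv: "u \<noteq> 0" "v \<noteq> 0" "- of_int D = (of_int u / of_int v :: rat)"
    "even (multiplicity p (u * v))" unfolding even_val_def by blast
  then have "of_int u = (of_int (- D * v) :: rat)" by (simp add: field_simps)
  then have u: "u = - D * v" by (simp only: of_int_eq_iff)
  have D0: "D \<noteq> 0" using assms(3) by auto
  have "\<not> p\<^sup>2 dvd D" using assms squarefreeD not_prime_unit by blast
  then have "multiplicity p D = 1"
    using assms(2) by (intro multiplicity_eqI) (simp_all add: power2_eq_square)
  moreover have "multiplicity p (u * v) = multiplicity p (- (D * v\<^sup>2))"
    by (simp add: u power2_eq_square mult.assoc)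
  moreover have "multiplicity p (D * v\<^sup>2) = multiplicity p D + multiplicity p (v\<^sup>2)"
    using assms(1) D0 uv by (intro prime_elem_multiplicity_mult_distrib) auto
  moreover have "multiplicity p (v\<^sup>2) = 2 * multiplicity p v"
    using assms(1) uv by (intro prime_elem_multiplicity_power_distrib) auto
  ultimately show False using uv(4) by simp
qed

text \<open>Here \<open>r\<close> and \<open>s\<close> are the roots of \<open>aX\<^sup>2 + bX + c\<close>; the bound on its Mahler measure
  forces them to lie on the same side of the unit circle.\<close>

lemma quadratic_bounded_mahler_discriminant:
  fixes a b c P D :: int and r s :: real
  assumes P: "prime P" "P dvd D" and "D > 0"
    and a: "a \<noteq> 0" and c: "c \<noteq> 0"
    and c_eq: "real_of_int c = a * (r * s)" and b_eq: "real_of_int b = - a * (r + s)"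
    and M: "\<bar>real_of_int a\<bar> * (max 1 \<bar>r\<bar> * max 1 \<bar>s\<bar>) \<le> P"
    and disc: "D dvd b\<^sup>2 - 4 * a * c" "b\<^sup>2 - 4 * a * c > 0"
    and b0: "b = 0 \<Longrightarrow> D dvd a * c"
    and odd: "odd (multiplicity P (c * a))"
  shows "D < P\<^sup>2"
proof -
  define R S where "R = \<bar>r\<bar>" and "S = \<bar>s\<bar>"
  define A C where "A = \<bar>real_of_int a\<bar>" and "C = \<bar>real_of_int c\<bar>"
  have A: "A \<ge> 1" using a by (simp add: A_def)
  have CA: "C = A * (R * S)" by (simp add: A_def C_def R_def S_def c_eq abs_mult)
  have RS: "R > 0" "S > 0" using c c_eq by (auto simp: R_def S_def)
  have M': "A * (max 1 R * max 1 S) \<le> P" using M by (simp add: A_def R_def S_def)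
  \<comment> \<open>Both \<open>1\<close> and \<open>R * S\<close> are at most the product of
    maxima, so the Mahler bound controls \<bar>a\<bar> and \<bar>c\<bar> at once.\<close>
  have "1 * 1 \<le> max 1 R * max 1 S" "R * S \<le> max 1 R * max 1 S"
    using RS by (intro mult_mono; simp)+
  then have "A * 1 \<le> A * (max 1 R * max 1 S)" "A * (R * S) \<le> A * (max 1 R * max 1 S)"
    using A by (intro mult_left_mono; simp)+
  then have AP: "\<bar>a\<bar> \<le> P" and CP: "\<bar>c\<bar> \<le> P" using M' CA unfolding A_def C_def by linarith+
  have "P dvd c * a" using odd not_dvd_imp_multiplicity_0 by fastforce
  then have "P dvd c \<or> P dvd a" using P(1) by (simp add: prime_dvd_mult_iff)
  then have eqP: "\<bar>c\<bar> = P \<or> \<bar>a\<bar> = P"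
    using AP CP a c P(1) by (metis abs_of_pos antisym dvd_abs_iff prime_gt_0_int zdvd_imp_le zero_less_abs_iff)
  \<comment> \<open>If both were \<open>P\<close>, then \<open>P\<close> would occur exactly twice
    in \<open>c * a\<close>, against the odd multiplicity.\<close>
  have ne: "\<not> (\<bar>c\<bar> = P \<and> \<bar>a\<bar> = P)"
  proof
    assume "\<bar>c\<bar> = P \<and> \<bar>a\<bar> = P"
    then have "\<bar>c * a\<bar> = P\<^sup>2" by (simp add: abs_mult power2_eq_square)
    then have "multiplicity P (c * a) = multiplicity P (P\<^sup>2)"
      by (metis multiplicity_normalize_right normalize_int_def)
    also have "\<dots> = 2" using P(1) by (intro multiplicity_same_power) auto
    finally show False using odd by simp
  qed
  have P0: "P > 0" using P(1) by (rule prime_gt_0_int)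
  have ac: "\<bar>a * c\<bar> < P\<^sup>2"
  proof -
    have "\<bar>a\<bar> * \<bar>c\<bar> < P * P"
      using eqP ne AP CP P0 by (metis mult_less_cancel_left_pos mult_less_cancel_right_pos order_less_le)
    then show ?thesis by (simp add: abs_mult power2_eq_square)
  qed
  \<comment> \<open>If \<bar>c\<bar> is \<open>P\<close>, the bound forces
    \<open>max 1 R * max 1 S = R * S\<close>; if \<bar>a\<bar> is \<open>P\<close>, it forces that
    product of maxima to be 1.\<close>
  have side: "(R \<ge> 1 \<and> S \<ge> 1 \<and> \<bar>c\<bar> = P) \<or> (R \<le> 1 \<and> S \<le> 1 \<and> \<bar>a\<bar> = P)"
    using eqP
  proof
    assume "\<bar>c\<bar> = P"
    then have "C = P" unfolding C_def by linarith
    then have "A * (max 1 R * max 1 S) \<le> A * (R * S)" using M' CA by simp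
    then have le: "max 1 R * max 1 S \<le> R * S" using A by simp
    have "R \<ge> 1"
    proof (rule ccontr)
      assume "\<not> R \<ge> 1"
      then have "R * S < 1 * max 1 S" using RS by (intro mult_less_le_imp_less) auto
      then show False using le \<open>\<not> R \<ge> 1\<close> by (simp add: max_def split: if_splits)
    qed
    moreover have "S \<ge> 1"
    proof (rule ccontr)
      assume "\<not> S \<ge> 1"
      then have "R * S < max 1 R * 1" using RS by (intro mult_le_less_imp_less) auto
      then show False using le \<open>\<not> S \<ge> 1\<close> by (simp add: max_def split: if_splits)
    qed
    ultimately show ?thesis using \<open>\<bar>c\<bar> = P\<close> by simp
  next
    assume "\<bar>a\<bar> = P"
    then have "A = P" unfolding A_def by linarith
    then have le: "max 1 R * max 1 S \<le> 1" using M' A by simp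
    have "max 1 R * 1 \<le> max 1 R * max 1 S" "1 * max 1 S \<le> max 1 R * max 1 S"
      by (intro mult_mono; simp)+
    then have "max 1 R \<le> 1" "max 1 S \<le> 1" using le by linarith+
    then show ?thesis using \<open>\<bar>a\<bar> = P\<close> by (simp add: max_def split: if_splits)
  qed
  have "P dvd b\<^sup>2"
  proof -
    have "P dvd b\<^sup>2 - 4 * a * c" using P(2) disc(1) by (rule dvd_trans)
    moreover have "P dvd 4 * a * c" using \<open>P dvd c * a\<close> by (metis dvd_mult mult.assoc mult.commute)
    ultimately show ?thesis by (metis dvd_add diff_add_cancel)
  qed
  then have Pb: "P dvd b" using P(1) prime_dvd_power by blast
  have B: "\<bar>real_of_int b\<bar> = A * \<bar>r + s\<bar>" unfolding b_eq A_def by (simp add: abs_mult)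
  show ?thesis
  proof (cases "r * s > 0")
    case True
    then have "\<bar>r + s\<bar> = R + S" unfolding R_def S_def by (auto simp: zero_less_mult_iff)
    \<comment> \<open>Expanding gives \<open>R + S \<le> 1 + R * S\<close>, hence
      \<open>\<bar>b\<bar> \<le> \<bar>a\<bar> + \<bar>c\<bar> < 2 * P\<close>; a non-zero multiple
      of \<open>P\<close> in this range is \<open>P\<close> up to sign.\<close>
    moreover have "0 \<le> (R - 1) * (S - 1)"
      using side by (auto intro: mult_nonneg_nonneg mult_nonpos_nonpos)
    ultimately have "\<bar>r + s\<bar> \<le> 1 + R * S" by (simp add: algebra_simps)
    then have "A * \<bar>r + s\<bar> \<le> A * (1 + R * S)" using A by (intro mult_left_mono) auto
    then have "\<bar>real_of_int b\<bar> \<le> A + C" using B CA by (simp add: algebra_simps)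
    then have "\<bar>b\<bar> \<le> \<bar>a\<bar> + \<bar>c\<bar>" unfolding A_def C_def by linarith
    then have b2P: "\<bar>b\<bar> < 2 * P" using AP CP ne by linarith
    have "real_of_int (a * c) = (real_of_int a)\<^sup>2 * (r * s)" using c_eq by (simp add: power2_eq_square)
    also have "\<dots> > 0" using a by (intro mult_pos_pos[OF _ True]) simp
    finally have ac0: "a * c > 0" by (simp only: of_int_0_less_iff)
    \<comment> \<open>For \<open>b = 0\<close> the discriminant \<open>- 4 * a * c\<close> would be
      negative.\<close>
    then have "b \<noteq> 0" using disc(2) by auto
    obtain k where k: "\<bar>b\<bar> = P * k" using Pb by (metis dvd_abs_iff dvdE)
    then have "k > 0" using \<open>b \<noteq> 0\<close> P0 by (metis zero_less_abs_iff zero_less_mult_pos)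
    moreover have "k < 2" using k b2P P0 by (metis mult.commute mult_less_cancel_left_pos)
    ultimately have "\<bar>b\<bar> = P" using k by (simp add: order_antisym)
    then have "b\<^sup>2 = P\<^sup>2" by (metis power2_abs)
    moreover have "D \<le> b\<^sup>2 - 4 * a * c" using disc by (rule zdvd_imp_le)
    ultimately show ?thesis using ac0 by simp
  next
    case False
    then have neg: "r * s < 0" using c c_eq by (auto simp: not_less le_less)
    then have "\<bar>r + s\<bar> = \<bar>R - S\<bar>" unfolding R_def S_def by (auto simp: mult_less_0_iff)
    \<comment> \<open>As \<open>R\<close> and \<open>S\<close> lie on the same side of 1, the two
      products below have the same sign. The bound obtained is \<open>\<bar>b\<bar> \<le>
      \<bar>\<bar>c\<bar> - \<bar>a\<bar>\<bar> < P\<close>, which leaves only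
      \<open>b = 0\<close>.\<close>
    moreover have "\<bar>R - S\<bar> \<le> \<bar>R * S - 1\<bar>"
    proof -
      have "0 \<le> (R + 1) * (S - 1) \<and> 0 \<le> (R - 1) * (S + 1) \<or> 0 \<le> (R + 1) * (1 - S) \<and> 0 \<le> (1 - R) * (S + 1)"
        using side RS by auto
      then show ?thesis by (auto simp: algebra_simps)
    qed
    ultimately have "A * \<bar>r + s\<bar> \<le> A * \<bar>R * S - 1\<bar>" using A by (intro mult_left_mono) auto
    also have "\<dots> = \<bar>A * (R * S - 1)\<bar>" using A by (simp add: abs_mult)
    also have "\<dots> = \<bar>C - A\<bar>" by (simp add: CA algebra_simps)
    finally have "\<bar>real_of_int b\<bar> \<le> \<bar>C - A\<bar>" using B by simp
    then have "\<bar>b\<bar> \<le> \<bar>\<bar>c\<bar> - \<bar>a\<bar>\<bar>" unfolding A_def C_def by linarith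
    also have "\<dots> < P" using AP CP a c by linarith
    finally have "b = 0" using Pb by (metis dvd_imp_le_int abs_of_pos P0 not_le)
    \<comment> \<open>The discriminant \<open>- 4 * a * c\<close> alone would give a bound weaker by
      a factor 4.\<close>
    then have "D dvd \<bar>a * c\<bar>" using b0 by simp
    then have "D \<le> \<bar>a * c\<bar>" using a c by (intro zdvd_imp_le) auto
    then show ?thesis using ac by simp
  qed
qed

section \<open>Norms and minimal polynomials in \<open>\<rat>(\<surd>D)\<close>\<close>

context
  fixes D :: int and \<delta> :: complex
  assumes sqf: "squarefree D" and D1: "D > 1" and \<delta>sq: "\<delta> * \<delta> = of_int D"
begin

lemma quadratic_rep_eq_0:
  assumes "of_rat x + of_rat y * \<delta> = 0"
  shows "x = 0 \<and> y = 0"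
proof -
  have "y = 0"
  proof (rule ccontr)
    assume "y \<noteq> 0"
    define r where "r = - x / y"
    have "\<delta> = of_rat r"
      using assms \<open>y \<noteq> 0\<close> by (simp add: r_def of_rat_divide of_rat_minus field_simps add_eq_0_iff)
    then have "of_rat (r * r) = (of_rat (of_int D) :: complex)"
      using \<delta>sq by (simp add: of_rat_mult)
    then have r: "r * r = of_int D" by (simp only: of_rat_eq_iff)
    then have "r \<noteq> 0" using D1 by auto
    \<comment> \<open>Using \<open>1 / r\<close> instead of \<open>r\<close> makes the integer equal
      to 1, so that \<open>D\<close> divides 1.\<close>
    then have "(1 / r)\<^sup>2 * of_int D = of_int 1"
      by (simp add: power2_eq_square flip: r)
    then obtain k where "1 = k\<^sup>2 * D" using squarefree_mult_square_int[OF sqf] by blast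
    then have "D dvd 1" by (metis dvd_triv_right)
    then show False using D1 by auto
  qed
  then show ?thesis using assms by simp
qed

lemma quadratic_rep_mult:
  "(of_rat x + of_rat y * \<delta>) * (of_rat x' + of_rat y' * \<delta>) =
    of_rat (x * x' + of_int D * (y * y')) + of_rat (x * y' + y * x') * \<delta>"
  using \<delta>sq by (simp add: of_rat_add of_rat_mult algebra_simps)

lemma is_complex_subfield_quadratic:
  "is_complex_subfield {of_rat x + of_rat y * \<delta> |x y. True}" (is "is_complex_subfield ?K")
  unfolding is_complex_subfield_def
proof (intro conjI ballI)
  have K: "of_rat x + of_rat y * \<delta> \<in> ?K" for x y by blast
  show "0 \<in> ?K" using K[of 0 0] by simp
  show "1 \<in> ?K" using K[of 1 0] by simp
  fix z assume "z \<in> ?K"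
  then obtain x y where z: "z = of_rat x + of_rat y * \<delta>" by blast
  show "- z \<in> ?K" using K[of "- x" "- y"] by (simp add: z of_rat_minus)
  show "inverse z \<in> ?K"
  \<comment> \<open>At 0 the convention \<open>inverse 0 = 0\<close> applies; otherwise the inverse
    is the conjugate divided by the norm \<open>N\<close>.\<close>
  proof (cases "z = 0")
    case True
    then show ?thesis using K[of 0 0] by simp
  next
    case False
    define N where "N = x * x - of_int D * (y * y)"
    have N: "z * (of_rat x + of_rat (- y) * \<delta>) = of_rat N"
      unfolding z quadratic_rep_mult by (simp add: N_def)
    have "of_rat x + of_rat (- y) * \<delta> \<noteq> 0"
      using False quadratic_rep_eq_0[of x "- y"] by (auto simp: z)
    then have "N \<noteq> 0" using N False by auto
    have "inverse z = of_rat (x / N) + of_rat (- y / N) * \<delta>"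
    proof (rule inverse_unique)
      have "z * (of_rat (x / N) + of_rat (- y / N) * \<delta>) =
          (z * (of_rat x + of_rat (- y) * \<delta>)) / of_rat N"
        by (simp add: of_rat_divide of_rat_minus diff_divide_distrib algebra_simps)
      then show "z * (of_rat (x / N) + of_rat (- y / N) * \<delta>) = 1" using N \<open>N \<noteq> 0\<close> by simp
    qed
    then show ?thesis using K by blast
  qed
  fix w assume "w \<in> ?K"
  then obtain x' y' where w: "w = of_rat x' + of_rat y' * \<delta>" by blast
  show "z * w \<in> ?K" unfolding z w quadratic_rep_mult by (rule K)
  show "z + w \<in> ?K" using K[of "x + x'" "y + y'"] by (simp add: z w of_rat_add algebra_simps)
qed

lemma rat_adjoin_subset: "rat_adjoin \<delta> \<subseteq> {of_rat x + of_rat y * \<delta> |x y. True}"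
proof -
  have "\<delta> = of_rat 0 + of_rat 1 * \<delta>" by simp
  then show ?thesis using is_complex_subfield_quadratic unfolding rat_adjoin_def by blast
qed

text \<open>The norm is multiplicative and sends \<open>\<delta>\<close> to \<open>- D\<close>,
  whose \<open>p\<close>-adic valuation is odd.\<close>

lemma ex_factor_odd_norm:
  assumes p: "prime p" "p dvd D" and \<beta>s: "prod_list \<beta>s = \<delta>" "set \<beta>s \<subseteq> rat_adjoin \<delta>"
  obtains x y where "of_rat x + of_rat y * \<delta> \<in> set \<beta>s" "\<not> even_val p (x * x - of_int D * (y * y))"
proof (rule ccontr)
  assume "\<not> thesis"
  then have ev: "\<And>x y. of_rat x + of_rat y * \<delta> \<in> set \<beta>s \<Longrightarrow> even_val p (x * x - of_int D * (y * y))"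
    using that by blast
  \<comment> \<open>The induction carries some representation with a norm of even valuation;
    uniqueness of the representation of \<open>\<delta>\<close> then makes that norm
    \<open>- D\<close>.\<close>
  have "\<exists>x y. prod_list \<beta>s = of_rat x + of_rat y * \<delta> \<and> even_val p (x * x - of_int D * (y * y))"
    using ev \<beta>s(2)
  proof (induction \<beta>s)
    case Nil
    have "even_val p 1" using even_val_square[OF p(1), of 1] by simp
    then show ?case by (intro exI[of _ 1] exI[of _ 0]) simp
  next
    case (Cons \<beta> \<beta>s)
    obtain x y where 1: "\<beta> = of_rat x + of_rat y * \<delta>"
      using Cons.prems rat_adjoin_subset by auto
    obtain x' y' where 2: "prod_list \<beta>s = of_rat x' + of_rat y' * \<delta>"
      "even_val p (x' * x' - of_int D * (y' * y'))"
      using Cons by auto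
    define X Y where "X = x * x' + of_int D * (y * y')" and "Y = x * y' + y * x'"
    have "even_val p (x * x - of_int D * (y * y))" using Cons.prems 1 by auto
    then have "even_val p ((x * x - of_int D * (y * y)) * (x' * x' - of_int D * (y' * y')))"
      using 2(2) by (rule even_val_mult[OF p(1)])
    also have "(x * x - of_int D * (y * y)) * (x' * x' - of_int D * (y' * y')) =
        X * X - of_int D * (Y * Y)"
      unfolding X_def Y_def by algebra
    finally show ?case using quadratic_rep_mult[of x y x' y'] 1 2(1)
      by (intro exI[of _ X] exI[of _ Y]) (simp add: X_def Y_def)
  qed
  then obtain x y where xy: "\<delta> = of_rat x + of_rat y * \<delta>" "even_val p (x * x - of_int D * (y * y))"
    using \<beta>s(1) by auto
  have "of_rat x + of_rat (y - 1) * \<delta> = 0" using xy(1) by (simp add: of_rat_diff algebra_simps)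
  then have "x = 0" "y = 1" using quadratic_rep_eq_0[of x "y - 1"] by auto
  then have "even_val p (- of_int D)" using xy(2) by simp
  then show False using not_even_val_minus_squarefree p sqf by blast
qed

text \<open>An explicit integer quadratic bounds the degree by 2; the coefficients of 1 and
  \<open>\<delta>\<close> in \<open>f(\<beta>) = 0\<close> give Vieta's relations for
  \<open>\<beta>\<close> and its conjugate.\<close>

lemma min_int_poly_quadratic:
  assumes \<beta>: "\<beta> = of_rat x + of_rat y * \<delta>" and y: "y \<noteq> 0"
  obtains a b c where "min_int_poly \<beta> = [:c, b, a:]" "a \<noteq> 0" "c \<noteq> 0"
    "of_int b = - 2 * of_int a * x" "of_int c = of_int a * (x * x - of_int D * (y * y))"
proof -
  obtain u v where uv: "quotient_of x = (u, v)" by (cases "quotient_of x")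
  obtain u' v' where uv': "quotient_of y = (u', v')" by (cases "quotient_of y")
  have v: "v > 0" "v' > 0" and xy: "x = of_int u / of_int v" "y = of_int u' / of_int v'"
    using uv uv' quotient_of_denom_pos quotient_of_div by blast+
  define z where "z = v * v'"
  define x1 y1 where "x1 = u * v'" and "y1 = u' * v"
  have z: "z \<noteq> 0" using v by (simp add: z_def)
  have x1: "complex_of_int z * of_rat x = of_int x1" and y1: "complex_of_int z * of_rat y = of_int y1"
    using v by (simp_all add: z_def x1_def y1_def xy of_rat_divide)
  \<comment> \<open>This is \<open>(z * X - x1)\<^sup>2 - D * y1\<^sup>2\<close>, that is,
    \<open>(X - x)\<^sup>2 - D * y\<^sup>2\<close> with denominators cleared.\<close>
  define g :: "int poly" where "g = [:x1 * x1 - D * (y1 * y1), - 2 * x1 * z, z * z:]"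
  have g: "g \<noteq> 0" "degree g = 2" using z by (simp_all add: g_def)
  have "of_int z * \<beta> = of_int x1 + of_int y1 * \<delta>" unfolding \<beta> x1[symmetric] y1[symmetric]
    by (simp add: algebra_simps)
  then have y1\<delta>: "of_int z * \<beta> - of_int x1 = of_int y1 * \<delta>" by simp
  have "poly (cpoly g) \<beta> = (of_int z * \<beta> - of_int x1) * (of_int z * \<beta> - of_int x1)
      - of_int D * (of_int y1 * of_int y1)"
    by (simp add: g_def map_poly_pCons algebra_simps)
  also have "\<dots> = 0" unfolding y1\<delta> \<delta>sq[symmetric] by simp
  finally have root: "poly (cpoly g) \<beta> = 0" .
  have alg: "algebraic \<beta>" using g(1) root by (rule algebraic_if_root)
  define f where "f = min_int_poly \<beta>"
  define a b c where "a = coeff f 2" and "b = coeff f 1" and "c = coeff f 0"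
  have "f dvd g" unfolding f_def using g(1) root by (rule min_int_poly_dvd)
  then have "degree f \<le> 2" using g by (metis dvd_imp_degree_le)
  then have f: "f = [:c, b, a:]"
    by (intro poly_eqI) (auto simp: a_def b_def c_def coeff_pCons coeff_eq_0 numeral_2_eq_2 split: nat.splits)
  have "\<beta> \<noteq> 0" using quadratic_rep_eq_0[of x y] y \<beta> by auto
  then have c: "c \<noteq> 0" using coeff_0_min_int_poly_nonzero[OF alg] by (simp add: c_def f_def)
  have "poly (cpoly f) \<beta> = 0"
    using is_min_int_poly_min_int_poly[OF alg] by (simp add: f_def is_min_int_poly_def)
  then have "of_int c + of_int b * \<beta> + of_int a * (\<beta> * \<beta>) = 0"
    by (simp add: f map_poly_pCons algebra_simps)
  then have "of_rat (of_int c + of_int b * x + of_int a * (x * x + of_int D * (y * y)))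
      + of_rat (of_int b * y + of_int a * (x * y + y * x)) * \<delta> = 0"
    unfolding \<beta> quadratic_rep_mult by (simp add: of_rat_add of_rat_mult algebra_simps)
  then have eqs: "of_int c + of_int b * x + of_int a * (x * x + of_int D * (y * y)) = 0"
    "of_int b * y + of_int a * (x * y + y * x) = 0"
    using quadratic_rep_eq_0 by blast+
  have "y * (of_int b + 2 * of_int a * x) = 0" using eqs(2) by (simp add: algebra_simps)
  then have b: "of_int b = - 2 * of_int a * x" using y by (simp add: add_eq_0_iff)
  have c': "of_int c = of_int a * (x * x - of_int D * (y * y))"
    using eqs(1) unfolding b by (simp add: algebra_simps)
  have "a \<noteq> 0" using c c' by auto
  then show thesis using that f c b c' unfolding f_def by blast
qed

end

lemma log_mahler_quadratic_exp_le:
  assumes "a \<noteq> 0" "P > 0"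
    and "log_mahler (smult (of_real a) ([:- of_real r, 1:] * [:- of_real s, 1:])) \<le> ln P"
  shows "\<bar>a\<bar> * (max 1 \<bar>r\<bar> * max 1 \<bar>s\<bar>) \<le> P"
proof -
  have exp_max: "exp (max 0 (ln \<bar>x\<bar>)) = max 1 \<bar>x\<bar>" for x :: real
  \<comment> \<open>At \<open>x = 0\<close> both sides are 1 since \<open>ln 0 = 0\<close>.\<close>
  proof (cases "x = 0")
    case False
    then show ?thesis by (auto simp: max_def)
  qed simp
  have "ln \<bar>a\<bar> + max 0 (ln \<bar>r\<bar>) + max 0 (ln \<bar>s\<bar>) \<le> ln P"
    using assms log_mahler_quadratic[of "of_real a" "of_real r" "of_real s"] by simp
  then have "exp (ln \<bar>a\<bar> + max 0 (ln \<bar>r\<bar>) + max 0 (ln \<bar>s\<bar>)) \<le> exp (ln P)"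
    by (simp only: exp_le_cancel_iff)
  then show ?thesis using assms unfolding exp_add exp_max by (simp add: mult.assoc)
qed

lemma discriminant_lt_of_bounded_factorization:
  fixes D P :: nat
  assumes sqf: "squarefree (int D)" and P: "prime P" "P dvd D" "D > 1"
    and \<delta>: "\<delta> = complex_of_real (sqrt (real D))"
    and fact: "is_factorization \<delta> \<beta>s" "set \<beta>s \<subseteq> rat_adjoin \<delta>"
    and M: "\<And>\<beta>. \<beta> \<in> set \<beta>s \<Longrightarrow> log_mahler_alg \<beta> \<le> ln (real P)"
  shows "D < P\<^sup>2"
proof -
  define E where "E = int D"
  have E: "E > 1" using P(3) by (simp add: E_def)
  have sqf': "squarefree E" using sqf by (simp add: E_def)
  have \<delta>sq: "\<delta> * \<delta> = of_int E" by (simp add: \<delta> E_def flip: of_real_mult)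
  have P': "prime (int P)" "int P dvd E" using P by (simp_all add: E_def)
  obtain x y where xy: "of_rat x + of_rat y * \<delta> \<in> set \<beta>s"
    and odd: "\<not> even_val (int P) (x * x - of_int E * (y * y))"
    using ex_factor_odd_norm[OF sqf' E \<delta>sq P'] fact unfolding is_factorization_def by metis
  define \<beta> where "\<beta> = of_rat x + of_rat y * \<delta>"
  have \<beta>0: "\<beta> \<noteq> 0" using fact(1) xy by (auto simp: is_factorization_def \<beta>_def)
  \<comment> \<open>For \<open>y = 0\<close> the norm would be \<open>x\<^sup>2\<close>, of even
    valuation.\<close>
  have y: "y \<noteq> 0"
  proof
    assume "y = 0"
    then have "x \<noteq> 0" using \<beta>0 by (auto simp: \<beta>_def)
    then show False
      using odd even_val_square[OF P'(1), of x] \<open>y = 0\<close> by (simp add: power2_eq_square)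
  qed
  obtain a b c where f: "min_int_poly \<beta> = [:c, b, a:]" and ac: "a \<noteq> 0" "c \<noteq> 0"
    and b: "of_int b = - 2 * of_int a * x" and c: "of_int c = of_int a * (x * x - of_int E * (y * y))"
    using min_int_poly_quadratic[OF sqf' E \<delta>sq \<beta>_def y] by blast
  define d where "d = sqrt (real D)"
  have dd: "d * d = of_int E" by (simp add: d_def E_def)
  \<comment> \<open>The real values of \<open>\<beta>\<close> and its conjugate.\<close>
  define r s where "r = real_of_rat x + of_rat y * d" and "s = real_of_rat x - of_rat y * d"
  have "real_of_rat (of_int b) = real_of_rat (- 2 * of_int a * x)" unfolding b ..
  then have rs_b: "real_of_int b = - a * (r + s)"
    by (simp add: r_def s_def of_rat_mult of_rat_minus)
  have "real_of_rat (of_int c) = real_of_rat (of_int a * (x * x - of_int E * (y * y)))" unfolding c ..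
  then have "real_of_int c = a * (of_rat x * of_rat x - (d * d) * (of_rat y * of_rat y))"
    unfolding dd by (simp add: of_rat_mult of_rat_diff)
  then have rs_c: "real_of_int c = a * (r * s)" by (simp add: r_def s_def algebra_simps)
  have "cpoly [:c, b, a:] = [:of_real (of_int c), of_real (of_int b), of_real (of_int a):]"
    by (simp add: map_poly_pCons)
  also have "\<dots> = smult (of_real (of_int a)) ([:- of_real r, 1:] * [:- of_real s, 1:])"
    unfolding rs_b rs_c by (simp add: algebra_simps)
  finally have "log_mahler (smult (of_real (of_int a)) ([:- of_real r, 1:] * [:- of_real s, 1:])) \<le> ln (real P)"
    using M[of \<beta>] xy f unfolding \<beta>_def log_mahler_alg_def by metis
  then have bound: "\<bar>real_of_int a\<bar> * (max 1 \<bar>r\<bar> * max 1 \<bar>s\<bar>) \<le> real P"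
    using ac P prime_gt_0_nat by (intro log_mahler_quadratic_exp_le) auto
  \<comment> \<open>The discriminant is an integer and \<open>D\<close> times a rational square;
    squarefreeness makes the square integral.\<close>
  have disc_eq: "(2 * of_int a * y)\<^sup>2 * of_int E = of_int (b\<^sup>2 - 4 * a * c)"
  proof -
    have "of_int (b\<^sup>2 - 4 * a * c) = (of_int b)\<^sup>2 - 4 * of_int a * (of_int c :: rat)" by simp
    also have "\<dots> = (2 * of_int a * y)\<^sup>2 * of_int E"
      unfolding b c by (simp add: power2_eq_square algebra_simps)
    finally show ?thesis ..
  qed
  then obtain k where k: "2 * of_int a * y = of_int k" "b\<^sup>2 - 4 * a * c = k\<^sup>2 * E"
    using squarefree_mult_square_int[OF sqf'] by blast
  have "k \<noteq> 0" using k(1) ac y by auto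
  have "E < (int P)\<^sup>2"
  proof (rule quadratic_bounded_mahler_discriminant)
    show "E dvd b\<^sup>2 - 4 * a * c" using k(2) by simp
    show "b\<^sup>2 - 4 * a * c > 0" unfolding k(2) using \<open>k \<noteq> 0\<close> E by simp
    show "E dvd a * c" if "b = 0"
    proof -
      have "x = 0" using b that ac by simp
      \<comment> \<open>With \<open>x = 0\<close>, the relation for \<open>c\<close> itself exhibits
        \<open>- a * c\<close> as \<open>D\<close> times a square, avoiding the factor 4.\<close>
      then have "(of_int a * y)\<^sup>2 * of_int E = of_int (- (a * c))"
        using c by (simp add: power2_eq_square)
      then have "E dvd - (a * c)" using squarefree_mult_square_int[OF sqf'] by fastforce
      then show ?thesis by simp
    qed
    show "odd (multiplicity (int P) (c * a))"
    proof
      assume "even (multiplicity (int P) (c * a))"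
      moreover have "x * x - of_int E * (y * y) = of_int c / of_int a" using c ac by simp
      ultimately have "even_val (int P) (x * x - of_int E * (y * y))"
        unfolding even_val_def using ac by blast
      then show False using odd by blast
    qed
  qed (use P' E ac rs_b rs_c bound in auto)
  then have "int D < int (P\<^sup>2)" by (simp add: E_def)
  then show ?thesis by (simp only: of_nat_less_iff)
qed

section \<open>Membership in the adjoined field, and the equivalence with its explicit
  minimum\<close>

lemma is_complex_subfield_of_nat: "is_complex_subfield K \<Longrightarrow> of_nat n \<in> K"
  by (induction n) (auto simp: is_complex_subfield_def)

lemma rat_adjoin_intros:
  shows "\<alpha> \<in> rat_adjoin \<alpha>" and "of_nat n \<in> rat_adjoin \<alpha>"
    and "x \<in> rat_adjoin \<alpha> \<Longrightarrow> y \<in> rat_adjoin \<alpha> \<Longrightarrow> x / y \<in> rat_adjoin \<alpha>"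
  by (auto simp: rat_adjoin_def is_complex_subfield_of_nat is_complex_subfield_def divide_inverse)

theorem theorem1p3:
  fixes p :: "nat \<Rightarrow> nat" and L D :: nat and t :: ereal
    and \<delta> :: complex and pts :: "complex list"
  assumes "L \<ge> 1"
    and "\<forall>l\<in>{1..L}. prime (p l)"
    and "\<forall>k\<in>{1..L}. \<forall>l\<in>{1..L}. k < l \<longrightarrow> p k > p l"
    and "D = (\<Prod>l=1..L. p l)"
    and "t > 1"
    and "\<delta> = complex_of_real (sqrt (real D))"
    and "pts = complex_of_real (sqrt (real (p 1) / real (\<Prod>l=2..L. p l)))
                 # map (\<lambda>l. of_nat (p l)) [2..<Suc L]"
  shows "(attained_in t \<delta> (rat_adjoin \<delta>) \<longleftrightarrow> D < (p 1)\<^sup>2) \<and>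
    (D < (p 1)\<^sup>2 \<longrightarrow>
       set pts \<subseteq> rat_adjoin \<delta> \<and>
       attained_by t \<delta> pts \<and>
       (t < \<infinity> \<longrightarrow> metric_mahler t \<delta> =
          (\<Sum>l=1..L. ln (real (p l)) powr real_of_ereal t) powr (1 / real_of_ereal t)) \<and>
       (t = \<infinity> \<longrightarrow> metric_mahler t \<delta> = ln (real (p 1))))"
proof -
  note L = assms(1) and prime_p = assms(2) and decr = assms(3) and D = assms(4) and t = assms(5)
    and \<delta> = assms(6) and pts = assms(7)
  \<comment> \<open>Since \<open>p\<close> is strictly decreasing, it is injective: indexed sums and
    products become those over \<open>Q\<close>, and \<open>Max Q = p 1\<close>.\<close>
  define Q where "Q = p ` {1..L}"
  define n where "n = (\<Prod>l=2..L. p l)"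
  have inj: "inj_on p {1..L}"
    using decr by (intro linorder_inj_onI) (auto simp: neq_iff)
  have fin: "finite Q" and ne: "Q \<noteq> {}" using L by (auto simp: Q_def)
  have primes: "prime q" if "q \<in> Q" for q using that prime_p by (auto simp: Q_def)
  have pos: "p l > 0" if "l \<in> {1..L}" for l using that prime_p prime_gt_0_nat by blast
  have p1: "p 1 \<in> Q" using L by (simp add: Q_def)
  have le_p1: "p l \<le> p 1" if "l \<in> {1..L}" for l
    using that decr L by (cases "l = 1") (auto intro: less_imp_le)
  have Max_Q: "Max Q = p 1"
    using fin p1 le_p1 by (intro Max_eqI) (auto simp: Q_def)
  have prod_Q: "\<Prod>Q = D" using inj by (simp add: Q_def D prod.reindex)
  have \<delta>sq: "\<delta>\<^sup>2 = of_nat (\<Prod>Q)"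
    by (simp add: \<delta> prod_Q flip: of_real_power)
  have ivl: "{1..L} = insert 1 {2..L}" using L by auto
  have D_eq: "D = p 1 * n" unfolding D n_def ivl by simp
  have n: "n > 0" unfolding n_def using pos by (intro prod_pos) auto
  have sqf: "squarefree (int D)"
  proof -
    have "squarefree (\<Prod>q\<in>Q. int q)"
      using primes by (intro squarefree_prod_coprime)
        (auto intro!: squarefree_prime primes_coprime simp: coprime_int_iff)
    then show ?thesis by (simp flip: prod_Q)
  qed
  have norm_eq: "primes_norm t Q = (if t = \<infinity> then ln (real (p 1)) else
      (\<Sum>l=1..L. ln (real (p l)) powr real_of_ereal t) powr (1 / real_of_ereal t))"
    unfolding primes_norm_def Max_Q using inj by (simp add: Q_def sum.reindex)
  define qs where "qs = map p [1..<Suc L]"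
  have qs: "distinct qs" "set qs = Q"
    using inj by (auto simp: qs_def Q_def distinct_map atLeastLessThanSuc_atLeastAtMost
        simp del: upt_Suc)
  have all_prime: "\<forall>q\<in>Q. prime q" using primes by blast
  note facts = fin ne all_prime \<delta>sq
  have metric_eq: "metric_mahler t \<delta> = primes_norm t Q"
  proof (rule metric_mahler_eq_primes_norm[OF facts])
    \<comment> \<open>These factors give the infimum for every \<open>D\<close>; the denominator 1
      fits them to the bound for square roots of quotients.\<close>
    let ?h = "\<lambda>q. complex_of_real (sqrt (real q / real 1))"
    have h: "algebraic (?h q) \<and> log_mahler_alg (?h q) \<le> ln (real q)" if "q \<in> Q" for q
      using sqrt_quotient_mahler[of q 1] prime_gt_0_nat[OF primes[OF that]]
        ln_prime_bounds(1)[OF facts that] by auto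
    show "mahler_lt t (map ?h qs) \<le> primes_norm t Q"
      by (rule mahler_lt_map_le_primes_norm[OF facts qs t]) (rule h)
    have "prod_list (map ?h qs) = (\<Prod>q\<in>Q. ?h q)" 
      using prod.distinct_set_conv_list[OF qs(1), of ?h] qs(2) by simp
    also have "\<dots> = complex_of_real (sqrt (real (\<Prod>Q)))"
      using fin by (induction Q) (simp_all add: real_sqrt_mult)
    finally show "is_factorization \<delta> (map ?h qs)"
      using h qs ne prime_gt_0_nat[OF primes] by (auto simp: is_factorization_def prod_Q \<delta>)
  qed (rule t)
  have "D < (p 1)\<^sup>2" if "attained_in t \<delta> (rat_adjoin \<delta>)"
  proof -
    obtain \<beta>s where \<beta>s: "set \<beta>s \<subseteq> rat_adjoin \<delta>" "is_factorization \<delta> \<beta>s"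
        "metric_mahler t \<delta> = mahler_lt t \<beta>s"
      using \<open>attained_in t \<delta> (rat_adjoin \<delta>)\<close> unfolding attained_in_def attained_by_def by blast
    have "log_mahler_alg \<beta> \<le> ln (real (p 1))" if "\<beta> \<in> set \<beta>s" for \<beta>
      using log_mahler_alg_le_if_mahler_lt_le[OF facts \<beta>s(2) t _ that] metric_eq \<beta>s(3) Max_Q by simp
    moreover have "D > 1"
    proof -
      have "p 1 * 1 \<le> p 1 * n" using n by (intro mult_le_mono2) simp
      then show ?thesis using D_eq prime_gt_1_nat[OF primes[OF p1]] by linarith
    qed
    ultimately show ?thesis
      using \<beta>s sqf primes[OF p1] D_eq \<delta> by (intro discriminant_lt_of_bounded_factorization) auto
  qed
  moreover have "set pts \<subseteq> rat_adjoin \<delta> \<and> attained_by t \<delta> pts" if less: "D < (p 1)\<^sup>2"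
  proof
    define \<alpha> where "\<alpha> = complex_of_real (sqrt (real (p 1) / real n))"
    have pts_\<alpha>: "pts = \<alpha> # map (\<lambda>l. of_nat (p l)) [2..<Suc L]" unfolding pts \<alpha>_def n_def ..
    \<comment> \<open>As \<open>D = p 1 * n\<close>, this is just the condition on \<open>D\<close>;
      it makes \<open>ln (p 1)\<close> the larger of the two logarithms bounding the measure of
      \<open>\<alpha>\<close>.\<close>
    have "n < p 1" using less by (simp add: D_eq power2_eq_square)
    have "real (p 1) / real n = real D / (real n)\<^sup>2" using n by (simp add: D_eq power2_eq_square)
    then have "sqrt (real (p 1) / real n) = sqrt (real D) / real n" by (simp add: real_sqrt_divide)
    then have \<alpha>: "\<alpha> = \<delta> / of_nat n" by (simp add: \<alpha>_def \<delta>)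
    then have "\<alpha> \<in> rat_adjoin \<delta>" by (simp add: rat_adjoin_intros)
    then show "set pts \<subseteq> rat_adjoin \<delta>"
      unfolding pts_\<alpha> by (auto intro: rat_adjoin_intros simp del: upt_Suc)
    \<comment> \<open>\<open>\<alpha>\<close> takes the place of \<open>p 1\<close> and every other
      prime stands for itself, so that \<open>pts\<close> has one factor per prime.\<close>
    define h where "h = (\<lambda>q. if q = p 1 then \<alpha> else of_nat q)"
    have upt: "[1..<Suc L] = 1 # [2..<Suc L]" using L by (simp add: upt_conv_Cons numeral_2_eq_2)
    have "p l \<noteq> p 1" if "l \<in> {2..L}" for l
    proof -
      have "p l < p 1" using decr[rule_format, of 1 l] that L by auto
      then show ?thesis by simp
    qed
    then have pts_eq: "pts = map h qs"
      unfolding qs_def upt pts_\<alpha> by (auto simp: h_def simp del: upt_Suc)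
    have "log_mahler_alg \<alpha> \<le> ln (real (p 1))"
      using sqrt_quotient_mahler(2)[of "p 1" n] n \<open>n < p 1\<close> by (simp add: \<alpha>_def)
    then have h: "algebraic (h q) \<and> log_mahler_alg (h q) \<le> ln (real q)" if "q \<in> Q" for q
      using sqrt_quotient_mahler(1)[of "p 1" n] n \<open>n < p 1\<close>
        log_mahler_alg_of_nat_le[of q] prime_gt_0_nat[OF primes[OF that]]
      by (auto simp: h_def \<alpha>_def)
    have le: "mahler_lt t pts \<le> primes_norm t Q"
      unfolding pts_eq by (rule mahler_lt_map_le_primes_norm[OF facts qs t]) (rule h)
    have "prod_list (map (\<lambda>l. of_nat (p l)) [2..<Suc L]) = (of_nat n :: complex)"
      using prod.distinct_set_conv_list[of "[2..<Suc L]" "\<lambda>l. of_nat (p l) :: complex"]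
      by (simp add: n_def atLeastLessThanSuc_atLeastAtMost del: upt_Suc)
    then have "prod_list pts = \<delta>"
      using n by (simp add: pts_\<alpha> \<alpha> del: upt_Suc)
    moreover have "h q \<noteq> 0" if "q \<in> Q" for q
      using n \<open>n < p 1\<close> prime_gt_0_nat[OF primes[OF that]] by (auto simp: h_def \<alpha>_def)
    ultimately have fact: "is_factorization \<delta> pts"
      using h qs ne by (auto simp: is_factorization_def pts_eq)
    have "mahler_lt t pts = primes_norm t Q"
      using le primes_norm_le_mahler_lt[OF facts fact t] by (rule antisym)
    then show "attained_by t \<delta> pts" using fact metric_eq by (simp add: attained_by_def)
  qed
  ultimately show ?thesis using metric_eq norm_eq unfolding attained_in_def by auto
qed

end
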